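(* Let $a,b,c\in\mathbb{R}$ and let $S$ be a symmetric matrix of one of the forms $$S= \begin{pmatrix} a & 0 & 1 \\ 0 & b & 0 \\ 1 & 0 & c \end{pmatrix}, \quad S= \begin{pmatrix} a & 1 & 0 \\ 1 & b & 0 \\ 0 & 0 & c \end{pmatrix} \quad\text{or}\quad S = \begin{pmatrix} a & 0 & 0 \\ 0 & b & 1 \\ 0 & 1 & c \end{pmatrix}.$$ Then $S$ is unitarily equivalent to a truncated Toeplitz operator (on some model space $K_\theta$), but $S$ is not the matrix representation of a truncated Toeplitz operator with respect to a modified Clark basis (that is, for no Blaschke product $\theta$ of order $3$ and no modified Clark basis of $K_\theta$ is $S$ the matrix representation of a truncated Toeplitz operator on $K_\theta$ with respect to that basis).
   Context: $\mathbb{D}$ is the open unit disc in $\mathbb{C}$ and $\mathbb{T}$ the unit circle. $H^2$ is the Hardy space of the disc, viewed via radial boundary values as a closed subspace of $L^2(\mathbb{T})$ (normalized Lebesgue measure; inner product linear in the first variable). A finite Blaschke product $\theta$ has order $n$ if it has $n$ zeros in $\mathbb{D}$ counted with multiplicity. The model space is $K_\theta = H^2 \ominus \theta H^2$; it is finite dimensional exactly when $\theta$ is a finite Blaschke product, and then its dimension is the order of $\theta$ and every $f\in K_\theta$ has a well-defined value at every point of $\mathbb{T}$. For $\zeta\in\mathbb{D}\cup\mathbb{T}$ the reproducing kernel is $k_\zeta(z)=\frac{1-\overline{\theta(\zeta)}\theta(z)}{1-\overline{\zeta}z}\in K_\theta$. Modified Clark basis: let $\theta$ be a finite Blaschke product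 of order $n$. For parameters $t\in\mathbb{D}$ and $\alpha\in\mathbb{T}$ put $w=\frac{\alpha+\theta(t)}{1+\overline{\theta(t)}\alpha}\in\mathbb{T}$. There are exactly $n$ distinct points $\eta_1,\dots,\eta_n$ with $\theta(\eta_i)=w$, all lying on $\mathbb{T}$. The corresponding modified Clark basis is the orthonormal basis of $K_\theta$ $$\mathbf{cb}_i(z)=\left(\overline{\eta_i}\,w\right)^{\frac12}\frac{k_{\eta_i}(z)}{\|k_{\eta_i}\|},\qquad i=1,\dots,n,$$ where the square root is the unimodular number with argument $\frac{\delta_1+\delta_2}{2}$, $\delta_1=\arg(\overline{\eta_i})\in[0,2\pi)$, $\delta_2=\arg(w)\in[0,2\pi)$. A modified Clark basis is any basis arising in this way for some $t\in\mathbb{D}$, $\alpha\in\mathbb{T}$. A truncated Toeplitz operator (TTO) on $K_\theta$ is an operator of the form $A_\phi f = P_\theta(\phi f)$, $f \in K_\theta$, for some $\phi\in L^\infty(\mathbb{T})$, where $P_\theta: L^2(\mathbb{T})\to K_\theta$ is the orthogonal projection. The matrix representation of an operator $A$ with respect to an orthonormal basis $v_1,\dots,v_n$ has $(i,j)$ entry $\langle A v_j, v_i\rangle$. A $3\times3$ matrix $S$ is regarded as an operator on $\mathbb{C}^3$; it is unitarily equivalent to an operator $A$ on $K_\theta$ if $S=W^{-1}AW$ for some unitary $W:\mathbb{C}^3\to K_\theta$. *)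

theory Defs
  imports "HOL-Analysis.Analysis"
begin

text \<open>Normalized Lebesgue measure on the unit circle \<open>\<T>\<close>, as a measure whose space is \<open>sphere 0 1\<close>.

  Elements of \<open>L\<^sup>2(\<T>)\<close> are represented by functions, and two functions represent the same element
  iff they agree almost everywhere (\<open>eq_circle\<close>). Values off the circle play no role for elements
  of \<open>L\<^sup>2(\<T>)\<close>.\<close>

definition circle_measure :: "complex measure" where
  "circle_measure = distr (uniform_measure lborel {0..<2*pi}) (restrict_space borel (sphere 0 1)) cis"

definition eq_circle :: "(complex \<Rightarrow> complex) \<Rightarrow> (complex \<Rightarrow> complex) \<Rightarrow> bool" (infix "=\<^sub>T" 50) where
  "f =\<^sub>T g \<longleftrightarrow> (AE z in circle_measure. f z = g z)"

definition L2_circle :: "(complex \<Rightarrow> complex) set" where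
  "L2_circle = {f \<in> borel_measurable circle_measure.
     integrable circle_measure (\<lambda>z. (norm (f z))\<^sup>2)}"

definition Linf_circle :: "(complex \<Rightarrow> complex) set" where
  "Linf_circle = {\<phi> \<in> borel_measurable circle_measure.
     \<exists>C. AE z in circle_measure. norm (\<phi> z) \<le> C}"

definition inner_circle :: "(complex \<Rightarrow> complex) \<Rightarrow> (complex \<Rightarrow> complex) \<Rightarrow> complex" where
  "inner_circle f g = (\<integral>z. f z * cnj (g z) \<partial>circle_measure)"

definition norm_circle :: "(complex \<Rightarrow> complex) \<Rightarrow> real" where
  "norm_circle f = sqrt (Re (inner_circle f f))"

text \<open>The Hardy space, through radial boundary values: \<open>F\<close> is the holomorphic function on the disc
  with bounded integral means, and \<open>f\<close> its boundary function.\<close>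

definition Hardy2 :: "(complex \<Rightarrow> complex) set" where
  "Hardy2 = {f \<in> L2_circle. \<exists>F. F holomorphic_on ball 0 1 \<and>
     (\<exists>M. \<forall>r::real. 0 \<le> r \<and> r < 1 \<longrightarrow> (\<integral>z. (norm (F (of_real r * z)))\<^sup>2 \<partial>circle_measure) \<le> M) \<and>
     (AE z in circle_measure. ((\<lambda>r::real. F (of_real r * z)) \<longlongrightarrow> f z) (at_left 1))}"

definition finite_Blaschke :: "nat \<Rightarrow> (complex \<Rightarrow> complex) \<Rightarrow> bool" where
  "finite_Blaschke n \<theta> \<longleftrightarrow> (\<exists>\<gamma> a. norm \<gamma> = 1 \<and> (\<forall>i<n. norm (a i) < 1) \<and>
     \<theta> = (\<lambda>z. \<gamma> * (\<Prod>i<n. (z - a i) / (1 - cnj (a i) * z))))"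

definition model_space :: "(complex \<Rightarrow> complex) \<Rightarrow> (complex \<Rightarrow> complex) set" where
  "model_space \<theta> = {f \<in> Hardy2. \<forall>h\<in>Hardy2. inner_circle f (\<lambda>z. \<theta> z * h z) = 0}"

text \<open>For \<open>\<zeta>\<close> on the circle the quotient is \<open>0/0\<close> at \<open>z = \<zeta>\<close>, where this function takes the value
  \<open>0\<close> instead of the limit; this is a null set of the circle.\<close>

definition kernel :: "(complex \<Rightarrow> complex) \<Rightarrow> complex \<Rightarrow> complex \<Rightarrow> complex" where
  "kernel \<theta> \<zeta> z = (1 - cnj (\<theta> \<zeta>) * \<theta> z) / (1 - cnj \<zeta> * z)"

text \<open>The index type \<open>'n\<close> enumerates the solutions \<open>\<eta>\<close> of \<open>\<theta> \<eta> = w\<close> in the closed disc (the domain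
  of \<open>\<theta>\<close>), in an arbitrary order. Since this enumeration is a bijection, \<open>CARD('n)\<close> is the order
  of \<open>\<theta>\<close>.\<close>

definition modified_Clark_basis ::
    "(complex \<Rightarrow> complex) \<Rightarrow> ('n::finite \<Rightarrow> complex \<Rightarrow> complex) \<Rightarrow> bool" where
  "modified_Clark_basis \<theta> v \<longleftrightarrow> (\<exists>t \<alpha> w \<eta>. norm t < 1 \<and> norm \<alpha> = 1 \<and>
     w = (\<alpha> + \<theta> t) / (1 + cnj (\<theta> t) * \<alpha>) \<and>
     bij_betw \<eta> UNIV {z \<in> cball 0 1. \<theta> z = w} \<and>
     v = (\<lambda>i z. cis ((Arg2pi (cnj (\<eta> i)) + Arg2pi w) / 2) *
            (kernel \<theta> (\<eta> i) z / of_real (norm_circle (kernel \<theta> (\<eta> i))))))"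

definition is_orthogonal_projection ::
    "(complex \<Rightarrow> complex) set \<Rightarrow> (complex \<Rightarrow> complex) \<Rightarrow> (complex \<Rightarrow> complex) \<Rightarrow> bool" where
  "is_orthogonal_projection K f g \<longleftrightarrow> g \<in> K \<and> (\<forall>h\<in>K. inner_circle (\<lambda>z. f z - g z) h = 0)"

text \<open>Only the restriction of \<open>A\<close> to \<open>K\<^sub>\<theta>\<close> matters. The condition determines each \<open>A f\<close> up to
  equality almost everywhere; linearity and compatibility with \<open>=\<^sub>T\<close> follow.\<close>

definition truncated_Toeplitz ::
    "(complex \<Rightarrow> complex) \<Rightarrow> ((complex \<Rightarrow> complex) \<Rightarrow> complex \<Rightarrow> complex) \<Rightarrow> bool" where
  "truncated_Toeplitz \<theta> A \<longleftrightarrow> (\<exists>\<phi>\<in>Linf_circle. \<forall>f\<in>model_space \<theta>.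
     is_orthogonal_projection (model_space \<theta>) (\<lambda>z. \<phi> z * f z) (A f))"

definition matrix_representation ::
    "((complex \<Rightarrow> complex) \<Rightarrow> complex \<Rightarrow> complex) \<Rightarrow> ('n::finite \<Rightarrow> complex \<Rightarrow> complex) \<Rightarrow> complex^'n^'n"
  where
  "matrix_representation A v = (\<chi> i j. inner_circle (A (v j)) (v i))"

definition unitary_onto ::
    "(complex \<Rightarrow> complex) set \<Rightarrow> (complex^'n::finite \<Rightarrow> complex \<Rightarrow> complex) \<Rightarrow> bool" where
  "unitary_onto K W \<longleftrightarrow>
     (\<forall>x. W x \<in> K) \<and>
     (\<forall>x y. W (x + y) =\<^sub>T (\<lambda>z. W x z + W y z)) \<and>
     (\<forall>c x. W (c *s x) =\<^sub>T (\<lambda>z. c * W x z)) \<and>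
     (\<forall>x y. inner_circle (W x) (W y) = (\<Sum>i\<in>UNIV. x $ i * cnj (y $ i))) \<and>
     (\<forall>f\<in>K. \<exists>x. W x =\<^sub>T f)"

text \<open>\<open>S = W\<inverse> A W\<close> is written as \<open>W S = A W\<close>.\<close>

definition unitarily_equivalent ::
    "complex^'n^'n::finite \<Rightarrow> (complex \<Rightarrow> complex) set \<Rightarrow>
     ((complex \<Rightarrow> complex) \<Rightarrow> complex \<Rightarrow> complex) \<Rightarrow> bool" where
  "unitarily_equivalent S K A \<longleftrightarrow>
     (\<exists>W. unitary_onto K W \<and> (\<forall>x. W (S *v x) =\<^sub>T A (W x)))"

end

theory Submission
  imports Defs "HOL-Complex_Analysis.Complex_Analysis"
begin

text \<open>
  \<^bold>\<open>Positive half.\<close> Take \<open>\<theta> = z\<^sup>N\<close>. Then \<open>K\<^sub>\<theta>\<close> consists of the polynomials of degree less than \<open>N\<close>, and the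
  truncated Toeplitz operators are exactly the \<open>N \<times> N\<close> Toeplitz matrices in the monomial basis. Every
  circulant matrix is Toeplitz, and the discrete Fourier matrix diagonalizes the circulants with
  arbitrary prescribed eigenvalues. Hence every unitarily diagonalizable matrix is unitarily equivalent
  to a truncated Toeplitz operator (\<open>unitarily_diagonalizable_imp_TTO\<close>). The three matrices in question
  are real symmetric: up to the order of the basis they are a \<open>2 \<times> 2\<close> block plus a scalar, so a plane
  rotation diagonalizes them.

  \<^bold>\<open>Negative half.\<close> Let \<open>k\<^sub>i\<close> be the kernels at the points \<open>\<eta>\<^sub>i\<close> with \<open>\<theta>(\<eta>\<^sub>i) = w\<close>. On the circle, partial
  fractions turn the product \<open>k\<^sub>j \<cdot> cnj k\<^sub>i\<close> with \<open>i \<noteq> j\<close> into a nonzero constant times \<open>g \<cdot> (k\<^sub>i - k\<^sub>j)\<close>, where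
  \<open>g\<close> is the same function for all pairs. Therefore the entry \<open>(i,j)\<close> of the matrix of a truncated
  Toeplitz operator with symbol \<open>\<phi>\<close> is a nonzero multiple of \<open>p\<^sub>i - p\<^sub>j\<close> with \<open>p\<^sub>i = \<integral> \<phi> g k\<^sub>i\<close>, and it vanishes
  iff \<open>p\<^sub>i = p\<^sub>j\<close> (\<open>Clark_matrix_off_diagonal_zeros\<close>). So the vanishing of off-diagonal entries is an
  equivalence relation on the indices. For three indices, two vanishing pairs force the third, whereas
  each of the given matrices has exactly one nonzero pair.

  Both halves need a little Hardy space theory. Dilations of a function in \<open>H\<^sup>2\<close> are bounded in \<open>L\<^sup>2\<close> and
  converge almost everywhere, hence in \<open>L\<^sup>1\<close>; so the Fourier coefficients of the boundary function are the
  Taylor coefficients of its extension (\<open>Fourier_coefficient_boundary_values\<close>). Since \<open>H\<^sup>2\<close> is stable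
  under multiplication by bounded analytic functions, all orthogonality relations reduce to
  \<open>\<integral> z\<^sup>m f = 0\<close> for \<open>m > 0\<close> and \<open>f \<in> H\<^sup>2\<close>.
\<close>

section \<open>Integration on the unit circle\<close>

lemma space_circle_measure: "space circle_measure = sphere 0 1"
  by (simp add: circle_measure_def space_restrict_space)

lemma sets_circle_measure: "sets circle_measure = sets (restrict_space borel (sphere 0 1))"
  by (simp add: circle_measure_def)

lemma measurable_cis: "cis \<in> measurable (uniform_measure lborel {0..<2*pi}) (restrict_space borel (sphere 0 1))"
proof -
  have "continuous_on UNIV cis"
    by (intro continuous_intros)
  then have "cis \<in> borel_measurable lborel"
    using borel_measurable_continuous_onI by auto
  then have "cis \<in> measurable lborel (restrict_space borel (sphere 0 1))"
    by (intro measurable_restrict_space2) auto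
  then show ?thesis
    by (simp cong: measurable_cong_sets)
qed

lemma finite_measure_circle: "finite_measure circle_measure"
proof -
  have "emeasure (uniform_measure lborel {0..<2*pi}) UNIV = 1"
    using emeasure_uniform_measure_1[of lborel "{0..<2*pi}"] by simp
  then have "finite_measure (uniform_measure lborel {0..<2*pi})"
    by (intro finite_measureI) simp
  then show ?thesis
    unfolding circle_measure_def by (rule finite_measure.finite_measure_distr[OF _ measurable_cis])
qed

lemma measurable_circle_continuous_on:
  "continuous_on (sphere 0 1) f \<Longrightarrow> f \<in> borel_measurable circle_measure"
  using borel_measurable_continuous_on_restrict[of "sphere 0 1" f]
  by (simp add: sets_circle_measure cong: measurable_cong_sets)

text \<open>The kernel at a boundary point \<open>\<eta>\<close> takes the conventional value \<open>0\<close> at \<open>\<eta>\<close>, which in general is not its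
  radial limit there. This is why single points of the circle have to be discarded.\<close>

lemma AE_circle_neq:
  "AE z in circle_measure. z \<noteq> \<eta>"
proof -
  have sub: "{x. cis x = \<eta>} \<inter> {0..<2*pi} \<subseteq> {Arg2pi \<eta>}"
    using cis_conv_exp by (auto intro!: Arg2pi_unique[symmetric, of 1] simp: mult.commute)
  have "AE x in lborel. x \<noteq> Arg2pi \<eta>"
    by (rule AE_lborel_singleton)
  then have "AE x in lborel. x \<in> {0..<2*pi} \<longrightarrow> cis x \<noteq> \<eta>"
    by eventually_elim (use sub in auto)
  then have "AE x in uniform_measure lborel {0..<2*pi}. cis x \<noteq> \<eta>"
    by (intro AE_uniform_measureI) auto
  moreover have "{z \<in> sphere 0 1. z \<noteq> \<eta>} \<in> sets (restrict_space borel (sphere 0 1))"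
    by (auto simp: sets_restrict_space intro!: image_eqI[of _ _ "- {\<eta>}"])
  ultimately show ?thesis
    unfolding circle_measure_def
    by (subst AE_distr_iff[OF measurable_cis]) (auto simp: space_restrict_space)
qed

lemma integral_circle_measure:
  fixes f :: "complex \<Rightarrow> complex"
  assumes f: "continuous_on (sphere 0 1) f"
    and I: "((\<lambda>t. f (cis t)) has_integral I) {0..2*pi}"
  shows "(\<integral>z. f z \<partial>circle_measure) = I / (2*pi)"
proof -
  have cont: "continuous_on {0..2*pi} (\<lambda>t. f (cis t))"
    by (rule continuous_on_compose2[OF f]) (auto intro!: continuous_intros)
  have si: "set_integrable lborel {0..2*pi} (\<lambda>t. f (cis t))"
    using borel_integrable_compact[OF _ cont] unfolding set_integrable_def
    by (simp add: indicator_def if_distrib cong: if_cong)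
  have mf: "f \<in> borel_measurable (restrict_space borel (sphere 0 1))"
    by (rule borel_measurable_continuous_on_restrict[OF f])
  have mfc: "(\<lambda>t. f (cis t)) \<in> borel_measurable lborel"
    using measurable_compose[OF measurable_cis mf] by (simp cong: measurable_cong_sets)
  have "(\<integral>z. f z \<partial>circle_measure) = (\<integral>t. f (cis t) \<partial>uniform_measure lborel {0..<2*pi})"
    unfolding circle_measure_def by (rule integral_distr[OF measurable_cis mf])
  also have "\<dots> = (\<integral>t. f (cis t) \<partial>density lborel (\<lambda>t. ennreal (indicator {0..<2*pi} t / (2*pi))))"
  proof -
    have "indicator {0..<2*pi} t / ennreal (2*pi) = ennreal (indicator {0..<2*pi} t / (2*pi))" for t
      by (auto simp: indicator_def divide_ennreal simp flip: ennreal_1)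
    then show ?thesis
      by (simp add: uniform_measure_def)
  qed
  also have "\<dots> = (\<integral>t. (indicator {0..<2*pi} t / (2*pi)) *\<^sub>R f (cis t) \<partial>lborel)"
    by (rule integral_density[OF mfc]) auto
  also have "\<dots> = (\<integral>t. indicator {0..2*pi} t *\<^sub>R f (cis t) / (2*pi) \<partial>lborel)"
  proof (rule integral_cong_AE)
    have "AE t in lborel. t \<noteq> 2*pi"
      by (rule AE_lborel_singleton)
    then show "AE t in lborel. (indicator {0..<2*pi} t / (2*pi)) *\<^sub>R f (cis t)
        = indicator {0..2*pi} t *\<^sub>R f (cis t) / (2*pi)"
      by eventually_elim (auto simp: indicator_def scaleR_conv_of_real)
  qed (use mfc in measurable)
  also have "\<dots> = (LINT t:{0..2*pi}|lborel. f (cis t)) / (2*pi)"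
    unfolding set_lebesgue_integral_def by (rule integral_divide_zero)
  also have "\<dots> = I / (2*pi)"
    using set_borel_integral_eq_integral(2)[OF si] integral_unique[OF I] by simp
  finally show ?thesis .
qed

text \<open>With \<open>u = r z\<close> and \<open>du = \<i> u dt\<close>, this is Cauchy's formula for the derivatives at \<open>0\<close> on the circle
  of radius \<open>r\<close>.\<close>

lemma integral_circle_dilation:
  assumes F: "F holomorphic_on ball 0 1" and r: "0 < r" "r < 1"
  shows "(\<integral>z. F (of_real r * z) * cnj z ^ k \<partial>circle_measure)
           = of_real r ^ k * ((deriv ^^ k) F 0 / fact k)"
proof -
  have Fc: "F holomorphic_on cball 0 r"
    using F by (rule holomorphic_on_subset) (use r in auto)
  have "((\<lambda>u. F u / (u - 0) ^ Suc k) has_contour_integral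
          (2 * pi * \<i>) / fact k * (deriv ^^ k) F 0) (circlepath 0 r)"
    using Fc r by (intro Cauchy_has_contour_integral_higher_derivative_circlepath
        holomorphic_on_imp_continuous_on holomorphic_on_subset[OF Fc]) auto
  then have "((\<lambda>t. F (0 + r * cis t) / (0 + r * cis t - 0) ^ Suc k * r * \<i> * cis t) has_integral
          (2 * pi * \<i>) / fact k * (deriv ^^ k) F 0) {0..2*pi}"
    unfolding circlepath_def by (subst (asm) has_contour_integral_part_circlepath_iff) auto
  from has_integral_mult_right[OF this, of "of_real r ^ k / \<i>"]
  have "((\<lambda>t. of_real r ^ k / \<i> * (F (r * cis t) / (r * cis t) ^ Suc k * r * \<i> * cis t)) has_integral
          of_real r ^ k * (2 * pi * ((deriv ^^ k) F 0 / fact k))) {0..2*pi}"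
    by (simp add: mult.commute mult.left_commute)
  moreover have "of_real r ^ k / \<i> * (F (r * cis t) / (r * cis t) ^ Suc k * r * \<i> * cis t)
       = F (of_real r * cis t) * cnj (cis t) ^ k" for t
    using r by (simp add: cis_cnj field_simps power_mult_distrib flip: power_inverse cis_inverse)
  ultimately have "((\<lambda>t. F (of_real r * cis t) * cnj (cis t) ^ k) has_integral
          of_real r ^ k * (2 * pi * ((deriv ^^ k) F 0 / fact k))) {0..2*pi}"
    by simp
  then have "(\<integral>z. F (of_real r * z) * cnj z ^ k \<partial>circle_measure)
      = of_real r ^ k * (2 * pi * ((deriv ^^ k) F 0 / fact k)) / (2*pi)"
    using r by (intro integral_circle_measure)
      (auto intro!: continuous_intros continuous_on_compose2[OF holomorphic_on_imp_continuous_on[OF F]]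
        simp: norm_mult)
  then show ?thesis by simp
qed

text \<open>Truncate \<open>h\<^sub>n = \<bar>s\<^sub>n - f\<bar>\<close> at height \<open>N\<close>. Dominated convergence applies to \<open>min h\<^sub>n N\<close>, and the excess
  is at most \<open>h\<^sub>n\<^sup>2 / N\<close>, whose integral is uniformly small for large \<open>N\<close>.\<close>

lemma L2_bounded_imp_L1_convergence:
  fixes f :: "'a \<Rightarrow> complex"
  assumes fin: "finite_measure M"
    and ms: "\<And>n. s n \<in> borel_measurable M" and mf: "f \<in> borel_measurable M"
    and is2: "\<And>n. integrable M (\<lambda>x. (norm (s n x))\<^sup>2)" and if2: "integrable M (\<lambda>x. (norm (f x))\<^sup>2)"
    and bnd: "\<And>n. (\<integral>x. (norm (s n x))\<^sup>2 \<partial>M) \<le> B"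
    and lim: "AE x in M. (\<lambda>n. s n x) \<longlonglongrightarrow> f x"
  shows "(\<lambda>n. \<integral>x. norm (s n x - f x) \<partial>M) \<longlonglongrightarrow> 0"
proof -
  interpret finite_measure M by fact
  define h where "h n x = norm (s n x - f x)" for n x
  define C where "C = 2 * B + 2 * (\<integral>x. (norm (f x))\<^sup>2 \<partial>M)"
  have mh [measurable]: "h n \<in> borel_measurable M" for n
    unfolding h_def using ms mf by measurable
  have h0: "0 \<le> h n x" for n x
    by (simp add: h_def)
  have h2le: "(h n x)\<^sup>2 \<le> 2 * (norm (s n x))\<^sup>2 + 2 * (norm (f x))\<^sup>2" for n x
  proof -
    have "(h n x)\<^sup>2 \<le> (norm (s n x) + norm (f x))\<^sup>2"
      unfolding h_def by (intro power_mono norm_triangle_ineq4) auto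
    also have "\<dots> \<le> 2 * (norm (s n x))\<^sup>2 + 2 * (norm (f x))\<^sup>2"
      using sum_squares_bound[of "norm (s n x)" "norm (f x)"] by (simp add: power2_sum)
    finally show ?thesis .
  qed
  have ih2: "integrable M (\<lambda>x. (h n x)\<^sup>2)" for n
    by (rule Bochner_Integration.integrable_bound[where f="\<lambda>x. 2 * (norm (s n x))\<^sup>2 + 2 * (norm (f x))\<^sup>2"])
       (use is2 if2 h2le in \<open>auto intro!: AE_I2\<close>)
  have h2: "(\<integral>x. (h n x)\<^sup>2 \<partial>M) \<le> C" for n
  proof -
    have "(\<integral>x. (h n x)\<^sup>2 \<partial>M) \<le> (\<integral>x. 2 * (norm (s n x))\<^sup>2 + 2 * (norm (f x))\<^sup>2 \<partial>M)"
      using ih2 is2 if2 h2le by (intro integral_mono) auto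
    also have "\<dots> \<le> C"
      using is2 if2 bnd[of n] by (simp add: C_def)
    finally show ?thesis .
  qed
  have C0: "0 \<le> C"
    by (rule order_trans[OF _ h2[of 0]]) (auto intro!: integral_nonneg_AE AE_I2)
  have imin: "integrable M (\<lambda>x. min (h n x) N)" if "N > 0" for n and N :: real
    using that h0 by (intro integrable_const_bound[where B=N]) (auto intro!: AE_I2)
  have split: "h n x \<le> min (h n x) N + (h n x)\<^sup>2 / N" if "N > 0" for n x and N :: real
  proof (cases "h n x \<le> N")
    case False
    then have "h n x * N \<le> h n x * h n x"
      by (intro mult_left_mono) (auto simp: h_def)
    then have "h n x \<le> (h n x)\<^sup>2 / N"
      using that by (simp add: power2_eq_square field_simps)
    then show ?thesis using that by (simp add: min_def h_def)
  qed (use that in \<open>auto simp: min_def\<close>)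
  have main: "(\<integral>x. h n x \<partial>M) \<le> (\<integral>x. min (h n x) N \<partial>M) + C / N" if N: "N > 0" for n and N :: real
  proof -
    have ih: "integrable M (\<lambda>x. min (h n x) N + (h n x)\<^sup>2 / N)"
      using imin[OF N] ih2 by auto
    have "(\<integral>x. h n x \<partial>M) \<le> (\<integral>x. min (h n x) N + (h n x)\<^sup>2 / N \<partial>M)"
      by (intro integral_mono ih Bochner_Integration.integrable_bound[OF ih])
         (use split[OF N] h0 in \<open>auto intro!: AE_I2 order_trans[OF _ abs_ge_self]\<close>)
    also have "\<dots> = (\<integral>x. min (h n x) N \<partial>M) + (\<integral>x. (h n x)\<^sup>2 \<partial>M) / N"
      using imin[OF N] ih2 by simp
    also have "\<dots> \<le> (\<integral>x. min (h n x) N \<partial>M) + C / N"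
      using h2 N by (simp add: divide_right_mono)
    finally show ?thesis .
  qed
  have tomin: "(\<lambda>n. \<integral>x. min (h n x) N \<partial>M) \<longlonglongrightarrow> 0" if N: "N > 0" for N :: real
  proof -
    have "(\<lambda>n. \<integral>x. min (h n x) N \<partial>M) \<longlonglongrightarrow> (\<integral>x. 0 \<partial>M)"
    proof (rule integral_dominated_convergence[where w="\<lambda>_. N"])
      show "AE x in M. (\<lambda>n. min (h n x) N) \<longlonglongrightarrow> 0"
        using lim
      proof eventually_elim
        case (elim x)
        then have "(\<lambda>n. h n x) \<longlonglongrightarrow> 0"
          unfolding h_def using tendsto_norm_zero[OF LIM_zero] by blast
        from tendsto_min[OF this tendsto_const[of N]] show ?case using N by simp
      qed
    qed (use N h0 in \<open>auto intro!: AE_I2\<close>)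
    then show ?thesis by simp
  qed
  have "(\<lambda>n. \<integral>x. h n x \<partial>M) \<longlonglongrightarrow> 0"
  proof (rule LIMSEQ_I)
    fix \<epsilon> :: real assume \<epsilon>: "0 < \<epsilon>"
    define N where "N = 2 * (C + 1) / \<epsilon>"
    have N: "N > 0" using C0 \<epsilon> by (simp add: N_def)
    have CN: "C / N < \<epsilon> / 2"
      using C0 \<epsilon> by (simp add: N_def field_simps)
    from LIMSEQ_D[OF tomin[OF N], of "\<epsilon>/2"] \<epsilon> obtain n0 where
      n0: "\<And>n. n \<ge> n0 \<Longrightarrow> \<bar>\<integral>x. min (h n x) N \<partial>M\<bar> < \<epsilon>/2" by auto
    have "norm ((\<integral>x. h n x \<partial>M) - 0) < \<epsilon>" if "n \<ge> n0" for n
    proof -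
      have "0 \<le> (\<integral>x. h n x \<partial>M)" by (intro integral_nonneg_AE AE_I2) (simp add: h_def)
      then have "norm ((\<integral>x. h n x \<partial>M) - 0) = (\<integral>x. h n x \<partial>M)" by simp
      then show ?thesis using main[OF N, of n] n0[OF that] CN by linarith
    qed
    then show "\<exists>no. \<forall>n\<ge>no. norm ((\<integral>x. h n x \<partial>M) - 0) < \<epsilon>" by blast
  qed
  then show ?thesis by (simp add: h_def)
qed

section \<open>Square integrable functions and the Hardy space\<close>

lemma measurable_id_circle [measurable]: "(\<lambda>z. z) \<in> borel_measurable circle_measure"
  by (intro measurable_circle_continuous_on continuous_intros)

lemma AE_circle_norm: "AE z in circle_measure. norm z = 1"
  using AE_space[of circle_measure] by (simp add: space_circle_measure)

lemma integrable_circle_bounded: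
  fixes f :: "complex \<Rightarrow> complex"
  assumes "f \<in> borel_measurable circle_measure" "AE z in circle_measure. norm (f z) \<le> C"
  shows "integrable circle_measure f"
  using finite_measure.integrable_const_bound[OF finite_measure_circle assms(2,1)] .

lemma L2_bounded:
  fixes f :: "complex \<Rightarrow> complex"
  assumes [measurable]: "f \<in> borel_measurable circle_measure"
    and C: "AE z in circle_measure. norm (f z) \<le> C"
  shows "f \<in> L2_circle"
proof -
  have "AE z in circle_measure. norm ((norm (f z))\<^sup>2) \<le> C\<^sup>2"
    using C by eventually_elim (simp add: power_mono)
  then have "integrable circle_measure (\<lambda>z. (norm (f z))\<^sup>2)"
    by (intro finite_measure.integrable_const_bound[OF finite_measure_circle]) auto
  then show ?thesis by (simp add: L2_circle_def)
qed

lemma L2_integrable_mult_cnj: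
  assumes "f \<in> L2_circle" "g \<in> L2_circle"
  shows "integrable circle_measure (\<lambda>z. f z * cnj (g z))"
proof (rule Bochner_Integration.integrable_bound)
  have [measurable]: "f \<in> borel_measurable circle_measure" "g \<in> borel_measurable circle_measure"
    using assms by (auto simp: L2_circle_def)
  have "cnj \<in> borel_measurable borel"
    by (intro borel_measurable_continuous_onI continuous_intros)
  then show "(\<lambda>z. f z * cnj (g z)) \<in> borel_measurable circle_measure"
    by measurable
  show "integrable circle_measure (\<lambda>z. (norm (f z))\<^sup>2 + (norm (g z))\<^sup>2)"
    using assms by (auto simp: L2_circle_def)
  have "norm (f z) * norm (g z) \<le> (norm (f z))\<^sup>2 + (norm (g z))\<^sup>2" for z
    using sum_squares_bound[of "norm (f z)" "norm (g z)"]
      zero_le_power2[of "norm (f z)"] zero_le_power2[of "norm (g z)"] by linarith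
  then show "AE z in circle_measure. norm (f z * cnj (g z)) \<le> norm ((norm (f z))\<^sup>2 + (norm (g z))\<^sup>2)"
    by (simp add: norm_mult)
qed

lemma L2_integrable: "f \<in> L2_circle \<Longrightarrow> integrable circle_measure f"
  using L2_integrable_mult_cnj[of f "\<lambda>_. 1"] L2_bounded[of "\<lambda>_. 1" 1] by simp

lemma L2_bounded_mult:
  assumes [measurable]: "g \<in> borel_measurable circle_measure"
    and C: "AE z in circle_measure. norm (g z) \<le> C" and f: "f \<in> L2_circle"
  shows "(\<lambda>z. g z * f z) \<in> L2_circle"
proof -
  have [measurable]: "f \<in> borel_measurable circle_measure"
    using f by (simp add: L2_circle_def)
  have "integrable circle_measure (\<lambda>z. (norm (g z * f z))\<^sup>2)"
  proof (rule Bochner_Integration.integrable_bound)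
    show "integrable circle_measure (\<lambda>z. C\<^sup>2 * (norm (f z))\<^sup>2)"
      using f by (simp add: L2_circle_def)
    show "AE z in circle_measure. norm ((norm (g z * f z))\<^sup>2) \<le> norm (C\<^sup>2 * (norm (f z))\<^sup>2)"
      using C by eventually_elim (simp add: norm_mult power_mult_distrib power_mono mult_right_mono)
  qed simp
  then show ?thesis by (simp add: L2_circle_def)
qed

lemma L2_add:
  assumes "f \<in> L2_circle" "g \<in> L2_circle"
  shows "(\<lambda>z. f z + g z) \<in> L2_circle"
proof -
  have [measurable]: "f \<in> borel_measurable circle_measure" "g \<in> borel_measurable circle_measure"
    using assms by (auto simp: L2_circle_def)
  have "(norm (f z + g z))\<^sup>2 \<le> 2 * (norm (f z))\<^sup>2 + 2 * (norm (g z))\<^sup>2" for z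
  proof -
    have "(norm (f z + g z))\<^sup>2 \<le> (norm (f z) + norm (g z))\<^sup>2"
      by (intro power_mono norm_triangle_ineq) auto
    also have "\<dots> \<le> 2 * (norm (f z))\<^sup>2 + 2 * (norm (g z))\<^sup>2"
      using sum_squares_bound[of "norm (f z)" "norm (g z)"] by (simp add: power2_sum)
    finally show ?thesis .
  qed
  then have le: "AE z in circle_measure. norm ((norm (f z + g z))\<^sup>2)
      \<le> norm (2 * (norm (f z))\<^sup>2 + 2 * (norm (g z))\<^sup>2)"
    by (intro AE_I2) simp
  have "integrable circle_measure (\<lambda>z. 2 * (norm (f z))\<^sup>2 + 2 * (norm (g z))\<^sup>2)"
    using assms by (simp add: L2_circle_def)
  from Bochner_Integration.integrable_bound[OF this _ le]
  have "integrable circle_measure (\<lambda>z. (norm (f z + g z))\<^sup>2)"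
    by simp
  then show ?thesis by (simp add: L2_circle_def)
qed

text \<open>The two conditions on the extension of a Hardy function are kept apart, since for bounded
  analytic functions only the first one has to be checked.\<close>

definition has_boundary_values :: "(complex \<Rightarrow> complex) \<Rightarrow> (complex \<Rightarrow> complex) \<Rightarrow> bool" where
  "has_boundary_values F f \<longleftrightarrow> F holomorphic_on ball 0 1 \<and>
     (AE z in circle_measure. ((\<lambda>r::real. F (of_real r * z)) \<longlongrightarrow> f z) (at_left 1))"

definition bounded_means :: "(complex \<Rightarrow> complex) \<Rightarrow> bool" where
  "bounded_means F \<longleftrightarrow> (\<exists>M. \<forall>r::real. 0 \<le> r \<and> r < 1 \<longrightarrow>
     (\<integral>z. (norm (F (of_real r * z)))\<^sup>2 \<partial>circle_measure) \<le> M)"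

lemma Hardy2_iff:
  "f \<in> Hardy2 \<longleftrightarrow> f \<in> L2_circle \<and> (\<exists>F. has_boundary_values F f \<and> bounded_means F)"
  by (auto simp: Hardy2_def has_boundary_values_def bounded_means_def)

lemma continuous_on_dilation:
  assumes "F holomorphic_on ball 0 1" "0 \<le> r" "r < 1"
  shows "continuous_on (sphere 0 1) (\<lambda>z. F (of_real r * z))"
  using assms by (intro continuous_on_compose2[OF holomorphic_on_imp_continuous_on[OF assms(1)]])
    (auto intro!: continuous_intros simp: norm_mult)

lemma integrable_dilation_power2:
  assumes "F holomorphic_on ball 0 1" "0 \<le> r" "r < 1"
  shows "integrable circle_measure (\<lambda>z. (norm (F (of_real r * z)))\<^sup>2)"
proof -
  have cont: "continuous_on (sphere 0 1) (\<lambda>z. F (of_real r * z))"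
    by (rule continuous_on_dilation[OF assms])
  then have "compact ((\<lambda>z. F (of_real r * z)) ` sphere 0 1)"
    by (rule compact_continuous_image) auto
  then have "bounded ((\<lambda>z. F (of_real r * z)) ` sphere 0 1)"
    by (rule compact_imp_bounded)
  then obtain B where "\<forall>x\<in>(\<lambda>z. F (of_real r * z)) ` sphere 0 1. norm x \<le> B"
    unfolding bounded_iff by blast
  then have B: "norm z = 1 \<Longrightarrow> norm (F (of_real r * z)) \<le> B" for z
    by simp
  have "AE z in circle_measure. norm (F (of_real r * z)) \<le> B"
    using AE_circle_norm by eventually_elim (rule B)
  then show ?thesis
    using L2_bounded[OF measurable_circle_continuous_on[OF cont]] by (simp add: L2_circle_def)
qed

text \<open>For the dilations \<open>F (r z)\<close> the formula holds with an additional factor \<open>r\<^sup>k\<close>. As \<open>r\<close> tends to \<open>1\<close>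
  they converge to \<open>f\<close> in \<open>L\<^sup>1\<close>, which suffices because \<open>cnj z ^ k\<close> is bounded.\<close>

lemma Fourier_coefficient_boundary_values:
  assumes f: "f \<in> L2_circle" and F: "has_boundary_values F f" and bF: "bounded_means F"
  shows "(\<integral>z. f z * cnj z ^ k \<partial>circle_measure) = (deriv ^^ k) F 0 / fact k"
proof -
  define r :: "nat \<Rightarrow> real" where "r n = 1 - 1 / (real n + 2)" for n
  have r: "0 < r n" "r n < 1" for n
    by (auto simp: r_def field_simps)
  have r1: "r \<longlonglongrightarrow> 1"
    unfolding r_def by real_asymp
  then have rl: "filterlim r (at_left 1) sequentially"
    using r by (auto simp: filterlim_at intro!: always_eventually less_imp_neq)
  define s where "s n z = F (of_real (r n) * z)" for n z
  have hol: "F holomorphic_on ball 0 1" using F by (simp add: has_boundary_values_def)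
  have sc: "continuous_on (sphere 0 1) (s n)" for n
    unfolding s_def using continuous_on_dilation[OF hol, of "r n"] r[of n] by simp
  have s2: "integrable circle_measure (\<lambda>z. (norm (s n z))\<^sup>2)" for n
    unfolding s_def using integrable_dilation_power2[OF hol, of "r n"] r[of n] by simp
  have fm [measurable]: "f \<in> borel_measurable circle_measure" using f by (simp add: L2_circle_def)
  have sm [measurable]: "s n \<in> borel_measurable circle_measure" for n
    by (rule measurable_circle_continuous_on[OF sc])
  obtain M where M: "\<And>r::real. 0 \<le> r \<and> r < 1 \<Longrightarrow>
      (\<integral>z. (norm (F (of_real r * z)))\<^sup>2 \<partial>circle_measure) \<le> M"
    using bF by (auto simp: bounded_means_def)
  have L1: "(\<lambda>n. \<integral>z. norm (s n z - f z) \<partial>circle_measure) \<longlonglongrightarrow> 0"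
  proof (rule L2_bounded_imp_L1_convergence[OF finite_measure_circle sm fm s2])
    show "integrable circle_measure (\<lambda>x. (norm (f x))\<^sup>2)" using f by (simp add: L2_circle_def)
    show "(\<integral>x. (norm (s n x))\<^sup>2 \<partial>circle_measure) \<le> M" for n
      unfolding s_def using M[of "r n"] r[of n] by simp
    have "AE z in circle_measure. ((\<lambda>r::real. F (of_real r * z)) \<longlongrightarrow> f z) (at_left 1)"
      using F by (simp add: has_boundary_values_def)
    then show "AE z in circle_measure. (\<lambda>n. s n z) \<longlonglongrightarrow> f z"
      unfolding s_def by eventually_elim (rule filterlim_compose[OF _ rl])
  qed
  have cnjm: "(\<lambda>z. cnj z ^ k) \<in> borel_measurable circle_measure"
    by (intro measurable_circle_continuous_on continuous_intros)
  have cb: "AE z in circle_measure. norm (cnj z ^ k) \<le> 1"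
    using AE_circle_norm by eventually_elim (simp add: norm_power)
  have int: "integrable circle_measure (\<lambda>z. g z * cnj z ^ k)" if "g \<in> L2_circle" for g
    using L2_integrable[OF L2_bounded_mult[OF cnjm cb that]] by (simp add: mult.commute)
  have sL2: "s n \<in> L2_circle" for n using s2 by (simp add: L2_circle_def)
  have diff: "norm ((\<integral>z. s n z * cnj z ^ k \<partial>circle_measure) - (\<integral>z. f z * cnj z ^ k \<partial>circle_measure))
      \<le> (\<integral>z. norm (s n z - f z) \<partial>circle_measure)" for n
  proof -
    have "(\<integral>z. s n z * cnj z ^ k \<partial>circle_measure) - (\<integral>z. f z * cnj z ^ k \<partial>circle_measure)
       = (\<integral>z. (s n z - f z) * cnj z ^ k \<partial>circle_measure)"
      using int[OF f] int[OF sL2] by (simp add: algebra_simps)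
    also have "norm \<dots> \<le> (\<integral>z. norm ((s n z - f z) * cnj z ^ k) \<partial>circle_measure)"
      by (rule integral_norm_bound)
    also have "\<dots> = (\<integral>z. norm (s n z - f z) \<partial>circle_measure)"
      by (rule Bochner_Integration.integral_cong[OF refl]) (simp add: norm_mult norm_power space_circle_measure)
    finally show ?thesis .
  qed
  have "(\<lambda>n. (\<integral>z. s n z * cnj z ^ k \<partial>circle_measure) - (\<integral>z. f z * cnj z ^ k \<partial>circle_measure)) \<longlonglongrightarrow> 0"
    by (rule Lim_null_comparison[OF _ L1]) (use diff in auto)
  then have "(\<lambda>n. \<integral>z. s n z * cnj z ^ k \<partial>circle_measure) \<longlonglongrightarrow> (\<integral>z. f z * cnj z ^ k \<partial>circle_measure)"
    by (rule LIM_zero_cancel)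
  moreover have "(\<lambda>n. \<integral>z. s n z * cnj z ^ k \<partial>circle_measure) \<longlonglongrightarrow> (deriv ^^ k) F 0 / fact k"
  proof -
    have "(\<integral>z. s n z * cnj z ^ k \<partial>circle_measure) = of_real (r n) ^ k * ((deriv ^^ k) F 0 / fact k)" for n
      unfolding s_def by (rule integral_circle_dilation[OF hol r])
    moreover have "(\<lambda>n. of_real (r n) ^ k * ((deriv ^^ k) F 0 / fact k)) \<longlonglongrightarrow> of_real 1 ^ k * ((deriv ^^ k) F 0 / fact k)"
      by (intro tendsto_intros r1)
    ultimately show ?thesis by simp
  qed
  ultimately show ?thesis by (rule LIMSEQ_unique)
qed

lemma has_boundary_values_mult:
  assumes "has_boundary_values F f" "has_boundary_values G g"
  shows "has_boundary_values (\<lambda>z. F z * G z) (\<lambda>z. f z * g z)"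
  unfolding has_boundary_values_def
proof
  show "(\<lambda>z. F z * G z) holomorphic_on ball 0 1"
    using assms by (auto simp: has_boundary_values_def intro!: holomorphic_intros)
  have "AE z in circle_measure. ((\<lambda>r::real. F (of_real r * z)) \<longlongrightarrow> f z) (at_left 1)"
    "AE z in circle_measure. ((\<lambda>r::real. G (of_real r * z)) \<longlongrightarrow> g z) (at_left 1)"
    using assms by (auto simp: has_boundary_values_def)
  then show "AE z in circle_measure. ((\<lambda>r::real. F (of_real r * z) * G (of_real r * z)) \<longlongrightarrow> f z * g z) (at_left 1)"
    by eventually_elim (rule tendsto_mult)
qed

lemma has_boundary_values_norm_le:
  assumes F: "has_boundary_values F f" and C: "\<And>z. norm z < 1 \<Longrightarrow> norm (F z) \<le> C"
  shows "AE z in circle_measure. norm (f z) \<le> C"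
proof -
  have "AE z in circle_measure. ((\<lambda>r::real. F (of_real r * z)) \<longlongrightarrow> f z) (at_left 1)"
    using F by (auto simp: has_boundary_values_def)
  then show ?thesis
    using AE_circle_norm
  proof eventually_elim
    case (elim z)
    have "eventually (\<lambda>r::real. r \<in> {0<..<1}) (at_left 1)"
      by (rule eventually_at_left_real) simp
    then have "eventually (\<lambda>r::real. norm (F (of_real r * z)) \<le> C) (at_left 1)"
      by eventually_elim (use elim(2) in \<open>auto intro!: C simp: norm_mult\<close>)
    from tendsto_upperbound[OF tendsto_norm[OF elim(1)] this] show ?case by simp
  qed
qed

lemma bounded_means_mult:
  assumes "G holomorphic_on ball 0 1" "\<And>z. norm z < 1 \<Longrightarrow> norm (G z) \<le> C"
    and "F holomorphic_on ball 0 1" "bounded_means F"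
  shows "bounded_means (\<lambda>z. G z * F z)"
proof -
  obtain M where M: "\<And>r::real. 0 \<le> r \<and> r < 1 \<Longrightarrow>
      (\<integral>z. (norm (F (of_real r * z)))\<^sup>2 \<partial>circle_measure) \<le> M"
    using assms by (auto simp: bounded_means_def)
  have "(\<integral>z. (norm (G (of_real r * z) * F (of_real r * z)))\<^sup>2 \<partial>circle_measure) \<le> C\<^sup>2 * M"
    if r: "0 \<le> r" "r < 1" for r :: real
  proof -
    have "(\<integral>z. (norm (G (of_real r * z) * F (of_real r * z)))\<^sup>2 \<partial>circle_measure)
        \<le> (\<integral>z. C\<^sup>2 * (norm (F (of_real r * z)))\<^sup>2 \<partial>circle_measure)"
    proof (rule integral_mono)
      have "(\<lambda>z. G z * F z) holomorphic_on ball 0 1"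
        using assms by (intro holomorphic_intros)
      from integrable_dilation_power2[OF this r]
      show "integrable circle_measure (\<lambda>z. (norm (G (of_real r * z) * F (of_real r * z)))\<^sup>2)" .
      show "integrable circle_measure (\<lambda>z. C\<^sup>2 * (norm (F (of_real r * z)))\<^sup>2)"
        using integrable_dilation_power2[OF assms(3) r] by simp
      fix z assume "z \<in> space circle_measure"
      then have "norm (G (of_real r * z)) \<le> C"
        using r by (intro assms) (simp add: space_circle_measure norm_mult)
      then show "(norm (G (of_real r * z) * F (of_real r * z)))\<^sup>2 \<le> C\<^sup>2 * (norm (F (of_real r * z)))\<^sup>2"
        by (simp add: norm_mult power_mult_distrib power_mono mult_right_mono)
    qed
    also have "\<dots> \<le> C\<^sup>2 * M"
      using M[of r] r by (simp add: mult_left_mono)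
    finally show ?thesis .
  qed
  then show ?thesis unfolding bounded_means_def by blast
qed

lemma Hardy2_bounded_mult:
  assumes G: "has_boundary_values G g" and C: "\<And>z. norm z < 1 \<Longrightarrow> norm (G z) \<le> C"
    and g: "g \<in> borel_measurable circle_measure" and f: "f \<in> Hardy2"
  shows "(\<lambda>z. g z * f z) \<in> Hardy2"
proof -
  from f obtain F where F: "has_boundary_values F f" "bounded_means F" and fL2: "f \<in> L2_circle"
    by (auto simp: Hardy2_iff)
  have "bounded_means (\<lambda>z. G z * F z)"
    using G F C by (intro bounded_means_mult[of G C F]) (auto simp: has_boundary_values_def)
  then show ?thesis
    using has_boundary_values_mult[OF G F(1)]
      L2_bounded_mult[OF g has_boundary_values_norm_le[OF G C] fL2] by (auto simp: Hardy2_iff)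
qed

lemma Hardy2_one: "(\<lambda>_. 1) \<in> Hardy2"
proof -
  have "has_boundary_values (\<lambda>_. 1) (\<lambda>_. 1)" "bounded_means (\<lambda>_. 1)"
    by (auto simp: has_boundary_values_def bounded_means_def)
  then show ?thesis
    using L2_bounded[of "\<lambda>_. 1" 1] by (auto simp: Hardy2_iff)
qed

lemma bounded_imp_Hardy2:
  assumes "has_boundary_values G g" "\<And>z. norm z < 1 \<Longrightarrow> norm (G z) \<le> C"
    "g \<in> borel_measurable circle_measure"
  shows "g \<in> Hardy2" "bounded_means G"
  using Hardy2_bounded_mult[OF assms Hardy2_one] 
    bounded_means_mult[of G C "\<lambda>_. 1"] assms
  by (auto simp: bounded_means_def has_boundary_values_def)

text \<open>One exceptional point \<open>\<eta>\<close> of the circle is admitted for the sake of the boundary kernels.\<close>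

lemma has_boundary_values_continuous:
  assumes cont: "continuous_on (cball 0 1 - {\<eta>}) F" and hol: "F holomorphic_on ball 0 1"
    and \<eta>: "norm \<eta> = 1"
  shows "has_boundary_values F F"
proof -
  have lim: "((\<lambda>r::real. F (of_real r * z)) \<longlongrightarrow> F z) (at_left 1)" if z: "norm z = 1" "z \<noteq> \<eta>" for z
  proof -
    have F: "(F \<longlongrightarrow> F z) (at z within cball 0 1 - {\<eta>})"
      using cont z by (auto simp: continuous_on_def)
    have "((\<lambda>r::real. of_real r * z) \<longlongrightarrow> of_real 1 * z) (at_left 1)"
      by (intro tendsto_intros)
    moreover have "eventually (\<lambda>r::real. r \<in> {0<..<1}) (at_left 1)"
      by (rule eventually_at_left_real) simp
    then have "eventually (\<lambda>r::real. of_real r * z \<in> cball 0 1 - {\<eta>} \<and> of_real r * z \<noteq> z) (at_left 1)"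
      by eventually_elim (use z \<eta> in \<open>auto simp: norm_mult\<close>)
    ultimately have "filterlim (\<lambda>r::real. of_real r * z) (at z within cball 0 1 - {\<eta>}) (at_left 1)"
      by (simp add: filterlim_at)
    from filterlim_compose[OF F this] show ?thesis .
  qed
  have "AE z in circle_measure. norm z = 1 \<and> z \<noteq> \<eta>"
    using AE_circle_norm AE_circle_neq[of \<eta>] by eventually_elim simp
  then have "AE z in circle_measure. ((\<lambda>r::real. F (of_real r * z)) \<longlongrightarrow> F z) (at_left 1)"
    by eventually_elim (use lim in blast)
  then show ?thesis
    using hol by (simp add: has_boundary_values_def)
qed

lemma has_boundary_values_power: "has_boundary_values (\<lambda>z. z ^ m) (\<lambda>z. z ^ m)"
  by (intro has_boundary_values_continuous[of 1] continuous_intros holomorphic_intros) simp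

lemma norm_power_le_one: "norm z < 1 \<Longrightarrow> norm (z ^ m) \<le> 1" for z :: complex
  by (simp add: norm_power power_le_one)

text \<open>The function \<open>z ^ m * f z\<close> is in \<open>H\<^sup>2\<close>, and its extension vanishes at \<open>0\<close>.\<close>

lemma Hardy2_integral_power_eq_0:
  assumes "f \<in> Hardy2" "0 < m"
  shows "(\<integral>z. z ^ m * f z \<partial>circle_measure) = 0"
proof -
  from assms obtain F where F: "has_boundary_values F f" "bounded_means F" and fL2: "f \<in> L2_circle"
    by (auto simp: Hardy2_iff)
  note P = has_boundary_values_power and b = norm_power_le_one
  have "bounded_means (\<lambda>z. z ^ m * F z)"
    using F P b by (intro bounded_means_mult[of "\<lambda>z. z ^ m" 1 F]) (auto simp: has_boundary_values_def)
  from Fourier_coefficient_boundary_values[OF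
      L2_bounded_mult[OF _ has_boundary_values_norm_le[OF P b] fL2]
      has_boundary_values_mult[OF P F(1)] this, of 0]
  show ?thesis using \<open>0 < m\<close> by simp
qed

section \<open>Finite Blaschke products and boundary kernels\<close>

lemma Blaschke_factor_denom_neq_0:
  assumes "norm a < 1" "norm z \<le> 1"
  shows "1 - cnj a * z \<noteq> (0::complex)"
proof
  assume "1 - cnj a * z = 0"
  then have "norm a * norm z = 1" by (metis complex_mod_cnj norm_mult norm_one right_minus_eq)
  moreover have "norm a * norm z \<le> norm a * 1"
    using assms by (intro mult_left_mono) auto
  ultimately show False using assms by simp
qed

lemma Blaschke_factor_identity:
  "(norm (1 - cnj a * z))\<^sup>2 - (norm (z - a))\<^sup>2 = (1 - (norm a)\<^sup>2) * (1 - (norm z)\<^sup>2)"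
  by (simp add: cmod_power2) algebra

lemma Blaschke_factor_norm:
  assumes a: "norm a < 1" and z: "norm z \<le> 1"
  shows "norm ((z - a) / (1 - cnj a * z)) \<le> 1"
    and "norm z < 1 \<Longrightarrow> norm ((z - a) / (1 - cnj a * z)) < 1"
    and "norm z = 1 \<Longrightarrow> norm ((z - a) / (1 - cnj a * z)) = 1"
proof -
  have d: "0 < norm (1 - cnj a * z)"
    using Blaschke_factor_denom_neq_0[OF assms] by simp
  have a1: "0 < 1 - (norm a)\<^sup>2" using a by (simp add: power_less_one_iff)
  have "0 \<le> 1 - (norm z)\<^sup>2" using z by (simp add: power_le_one)
  then have "(norm (z - a))\<^sup>2 \<le> (norm (1 - cnj a * z))\<^sup>2"
    using Blaschke_factor_identity[of a z] mult_nonneg_nonneg[OF less_imp_le[OF a1]] by (metis diff_ge_0_iff_ge)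
  then have "norm (z - a) \<le> norm (1 - cnj a * z)"
    by (rule power2_le_imp_le) simp
  then show "norm ((z - a) / (1 - cnj a * z)) \<le> 1"
    using d by (simp add: norm_divide)
  show "norm ((z - a) / (1 - cnj a * z)) < 1" if "norm z < 1"
  proof -
    have "0 < 1 - (norm z)\<^sup>2" using that by (simp add: power_less_one_iff)
    then have "(norm (z - a))\<^sup>2 < (norm (1 - cnj a * z))\<^sup>2"
      using Blaschke_factor_identity[of a z] mult_pos_pos[OF a1] by (metis diff_gt_0_iff_gt)
    then have "norm (z - a) < norm (1 - cnj a * z)"
      by (rule power2_less_imp_less) simp
    then show ?thesis using d by (simp add: norm_divide)
  qed
  show "norm ((z - a) / (1 - cnj a * z)) = 1" if "norm z = 1"
  proof -
    have "(norm (z - a))\<^sup>2 = (norm (1 - cnj a * z))\<^sup>2"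
      using Blaschke_factor_identity[of a z] that by simp
    then have "norm (z - a) = norm (1 - cnj a * z)"
      by (rule power2_eq_imp_eq) auto
    then show ?thesis using d by (simp add: norm_divide)
  qed
qed

lemma finite_Blaschke_norm:
  assumes "finite_Blaschke n \<theta>" "norm z \<le> 1"
  shows "norm z = 1 \<Longrightarrow> norm (\<theta> z) = 1"
    and "norm z < 1 \<Longrightarrow> 0 < n \<Longrightarrow> norm (\<theta> z) < 1"
proof -
  from assms obtain \<gamma> a where \<gamma>: "norm \<gamma> = 1" and a: "\<And>i. i < n \<Longrightarrow> norm (a i) < 1"
    and \<theta>: "\<theta> = (\<lambda>z. \<gamma> * (\<Prod>i<n. (z - a i) / (1 - cnj (a i) * z)))"
    by (auto simp: finite_Blaschke_def)
  have norm_\<theta>: "norm (\<theta> z) = (\<Prod>i<n. norm ((z - a i) / (1 - cnj (a i) * z)))"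
    using \<gamma> by (simp add: \<theta> norm_mult prod_norm)
  have le: "(\<Prod>i<m. norm ((z - a i) / (1 - cnj (a i) * z))) \<le> 1" if "m \<le> n" for m
    using that assms(2) by (intro prod_le_1) (auto intro!: Blaschke_factor_norm a)
  show "norm (\<theta> z) = 1" if "norm z = 1"
    unfolding norm_\<theta> using that a by (intro prod.neutral ballI Blaschke_factor_norm) auto
  show "norm (\<theta> z) < 1" if z: "norm z < 1" and n: "0 < n"
  proof -
    obtain m where m: "n = Suc m" using n gr0_conv_Suc by blast
    let ?b = "\<lambda>i. norm ((z - a i) / (1 - cnj (a i) * z))"
    have "norm (\<theta> z) = (\<Prod>i<m. ?b i) * ?b m"
      by (simp only: norm_\<theta> m prod.lessThan_Suc)
    also have "\<dots> \<le> 1 * ?b m"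
      using le[of m] m by (intro mult_right_mono) auto
    also have "\<dots> < 1"
      using Blaschke_factor_norm(2)[of "a m" z] a[of m] m z by simp
    finally show ?thesis .
  qed
qed

lemma finite_Blaschke_holomorphic:
  assumes "finite_Blaschke n \<theta>"
  obtains U where "open U" "cball 0 1 \<subseteq> U" "\<theta> holomorphic_on U"
proof -
  from assms obtain \<gamma> a where \<gamma>: "norm \<gamma> = 1" and a: "\<And>i. i < n \<Longrightarrow> norm (a i) < 1"
    and \<theta>: "\<theta> = (\<lambda>z. \<gamma> * (\<Prod>i<n. (z - a i) / (1 - cnj (a i) * z)))"
    by (auto simp: finite_Blaschke_def)
  let ?U = "\<Inter>i<n. {z. 1 - cnj (a i) * z \<noteq> 0}"
  show thesis
  proof
    show "open ?U"
      by (rule open_INT) (auto intro!: open_Collect_neq intro: continuous_intros)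
    show "cball 0 1 \<subseteq> ?U"
      using Blaschke_factor_denom_neq_0 a by auto
    show "\<theta> holomorphic_on ?U"
      unfolding \<theta> by (intro holomorphic_on_mult holomorphic_on_const holomorphic_on_prod
          holomorphic_on_divide holomorphic_on_diff holomorphic_on_ident) auto
  qed
qed

lemma unimodular_mult_cnj: "norm z = 1 \<Longrightarrow> z * cnj z = 1" "norm z = 1 \<Longrightarrow> cnj z * z = 1"
  using complex_norm_square[of z] by (simp_all add: mult.commute)

lemma boundary_kernel_denom_neq_0:
  assumes "norm \<eta> = 1" "z \<noteq> \<eta>"
  shows "1 - cnj \<eta> * z \<noteq> 0"
proof
  assume "1 - cnj \<eta> * z = 0"
  then have "\<eta> * (cnj \<eta> * z) = \<eta>" by simp
  then show False
    using assms unimodular_mult_cnj(1)[of \<eta>] by (metis mult.assoc mult_1)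
qed

lemma kernel_at_boundary_point:
  assumes "norm (\<theta> \<eta>) = 1"
  shows "kernel \<theta> \<eta> \<eta> = 0"
  using assms by (simp add: kernel_def unimodular_mult_cnj)

context
  fixes \<theta> :: "complex \<Rightarrow> complex" and n :: nat
  assumes \<theta>: "finite_Blaschke n \<theta>"
begin

lemma finite_Blaschke_continuous: "continuous_on (cball 0 1) \<theta>"
  and finite_Blaschke_holomorphic_ball: "\<theta> holomorphic_on ball 0 1"
proof -
  obtain U where "cball 0 1 \<subseteq> U" "\<theta> holomorphic_on U"
    using finite_Blaschke_holomorphic[OF \<theta>] .
  then have "\<theta> holomorphic_on cball 0 1"
    using holomorphic_on_subset by blast
  then show "continuous_on (cball 0 1) \<theta>" "\<theta> holomorphic_on ball 0 1"
    by (auto intro: holomorphic_on_imp_continuous_on holomorphic_on_subset)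
qed

lemma boundary_kernel_continuous:
  assumes "norm \<eta> = 1"
  shows "continuous_on (cball 0 1 - {\<eta>}) (kernel \<theta> \<eta>)"
  unfolding kernel_def using boundary_kernel_denom_neq_0[OF assms]
  by (intro continuous_intros continuous_on_subset[OF finite_Blaschke_continuous]) auto

lemma boundary_kernel_measurable:
  assumes "norm \<eta> = 1"
  shows "kernel \<theta> \<eta> \<in> borel_measurable circle_measure"
proof -
  have [measurable]: "\<theta> \<in> borel_measurable circle_measure"
    by (intro measurable_circle_continuous_on continuous_on_subset[OF finite_Blaschke_continuous]) auto
  show ?thesis
    unfolding kernel_def by measurable
qed

text \<open>Up to a unimodular factor, the kernel is the difference quotient of \<open>\<theta>\<close> at \<open>\<eta>\<close>. As \<open>\<theta>\<close> is
  holomorphic across the circle, this quotient extends continuously to the compact disc.\<close>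

lemma boundary_kernel_bounded:
  assumes \<eta>: "norm \<eta> = 1"
  shows "\<exists>C. \<forall>z. norm z \<le> 1 \<longrightarrow> norm (kernel \<theta> \<eta> z) \<le> C"
proof -
  obtain U where U: "open U" "cball 0 1 \<subseteq> U" "\<theta> holomorphic_on U"
    using finite_Blaschke_holomorphic[OF \<theta>] .
  define D where "D z = (if z = \<eta> then deriv \<theta> \<eta> else (\<theta> z - \<theta> \<eta>) / (z - \<eta>))" for z
  have "\<eta> \<in> interior U" using U \<eta> by (auto simp: interior_open)
  then have "D holomorphic_on U"
    unfolding D_def using pole_lemma[OF U(3)] by blast
  then have "continuous_on (cball 0 1) D"
    using U(2) by (meson continuous_on_subset holomorphic_on_imp_continuous_on)
  then have "bounded (D ` cball 0 1)"
    by (intro compact_imp_bounded compact_continuous_image) auto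
  then obtain C where C: "\<And>z. norm z \<le> 1 \<Longrightarrow> norm (D z) \<le> C"
    unfolding bounded_iff by (metis imageI mem_cball_0)
  show ?thesis
  proof (intro exI allI impI)
    fix z :: complex assume z: "norm z \<le> 1"
    have n\<theta>: "norm (\<theta> \<eta>) = 1" using finite_Blaschke_norm(1)[OF \<theta>] \<eta> by simp
    show "norm (kernel \<theta> \<eta> z) \<le> C"
    proof (cases "z = \<eta>")
      case True
      then show ?thesis
        using kernel_at_boundary_point[of \<theta>, OF n\<theta>] order_trans[OF norm_ge_zero C[OF z]] by simp
    next
      case False
      have "norm (\<theta> \<eta> * (1 - cnj (\<theta> \<eta>) * \<theta> z)) = norm (\<theta> z - \<theta> \<eta>)"
        using unimodular_mult_cnj(1)[OF n\<theta>] by (simp add: right_diff_distrib norm_minus_commute flip: mult.assoc)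
      moreover have "norm (\<eta> * (1 - cnj \<eta> * z)) = norm (z - \<eta>)"
        using unimodular_mult_cnj(1)[OF \<eta>] by (simp add: right_diff_distrib norm_minus_commute flip: mult.assoc)
      ultimately have "norm (kernel \<theta> \<eta> z) = norm (D z)"
        using False \<eta> n\<theta> by (simp add: kernel_def D_def norm_mult norm_divide)
      then show ?thesis using C[OF z] by simp
    qed
  qed
qed

lemma boundary_kernel_has_boundary_values:
  assumes \<eta>: "norm \<eta> = 1"
  shows "has_boundary_values (kernel \<theta> \<eta>) (kernel \<theta> \<eta>)"
proof (rule has_boundary_values_continuous[OF boundary_kernel_continuous[OF \<eta>] _ \<eta>])
  show "kernel \<theta> \<eta> holomorphic_on ball 0 1"
    unfolding kernel_def using boundary_kernel_denom_neq_0[OF \<eta>] \<eta>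
    by (intro holomorphic_intros finite_Blaschke_holomorphic_ball) (metis dist_0_norm less_irrefl mem_ball)
qed

lemma boundary_kernel_Hardy2:
  assumes \<eta>: "norm \<eta> = 1"
  shows "kernel \<theta> \<eta> \<in> Hardy2" "bounded_means (kernel \<theta> \<eta>)"
proof -
  obtain C where "\<And>z. norm z \<le> 1 \<Longrightarrow> norm (kernel \<theta> \<eta> z) \<le> C"
    using boundary_kernel_bounded[OF \<eta>] by blast
  then show "kernel \<theta> \<eta> \<in> Hardy2" "bounded_means (kernel \<theta> \<eta>)"
    using bounded_imp_Hardy2[OF boundary_kernel_has_boundary_values[OF \<eta>] _ boundary_kernel_measurable[OF \<eta>]]
    by (meson less_imp_le)+
qed

text \<open>Since \<open>\<theta>\<close> is unimodular on the circle, \<open>cnj k\<close> agrees there with an analytic function divided by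
  \<open>\<theta>\<close>. The factor \<open>z\<close> on the right is what makes \<open>k\<close> orthogonal to \<open>\<theta> H\<^sup>2\<close>.\<close>

lemma cnj_boundary_kernel:
  assumes \<eta>: "norm \<eta> = 1" and z: "norm z = 1"
  shows "cnj (kernel \<theta> \<eta> z) * \<theta> z = \<theta> \<eta> * cnj \<eta> * z * kernel \<theta> \<eta> z"
proof (cases "z = \<eta>")
  case True
  then show ?thesis
    using kernel_at_boundary_point finite_Blaschke_norm(1)[OF \<theta>, of \<eta>] \<eta> by simp
next
  case False
  note u = unimodular_mult_cnj
  have w: "norm (\<theta> \<eta>) = 1" "norm (\<theta> z) = 1"
    using finite_Blaschke_norm(1)[OF \<theta>] \<eta> z by auto
  have d1: "1 - cnj \<eta> * z \<noteq> 0" by (rule boundary_kernel_denom_neq_0[OF \<eta> False])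
  have d2: "1 - \<eta> * cnj z \<noteq> 0" using d1 by (metis complex_cnj_cnj complex_cnj_diff complex_cnj_mult complex_cnj_one complex_cnj_zero)
  have "(1 - \<theta> \<eta> * cnj (\<theta> z)) * \<theta> z * (1 - cnj \<eta> * z)
      = \<theta> \<eta> * cnj \<eta> * z * (1 - cnj (\<theta> \<eta>) * \<theta> z) * (1 - \<eta> * cnj z)"
    using u[OF \<eta>] u[OF z] u[OF w(1)] u[OF w(2)] by algebra
  then show ?thesis
    using d1 d2 by (simp add: kernel_def field_simps)
qed

text \<open>Partial fractions: both kernels have the same numerator, because \<open>\<theta>\<close> takes the same value at both
  points. At the points \<open>\<eta>\<close> and \<open>\<zeta>\<close> themselves this common numerator is zero.\<close>

lemma boundary_kernel_mult:
  assumes "norm \<eta> = 1" "norm \<zeta> = 1" "\<theta> \<eta> = w" "\<theta> \<zeta> = w"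
  shows "(cnj \<eta> - cnj \<zeta>) * z * (kernel \<theta> \<eta> z * kernel \<theta> \<zeta> z)
           = (1 - cnj w * \<theta> z) * (kernel \<theta> \<eta> z - kernel \<theta> \<zeta> z)"
proof -
  have w: "norm w = 1" using finite_Blaschke_norm(1)[OF \<theta>, of \<eta>] assms by simp
  consider "z = \<eta> \<or> z = \<zeta>" | "z \<noteq> \<eta>" "z \<noteq> \<zeta>" by blast
  then show ?thesis
  proof cases
    case 1
    then show ?thesis
      using unimodular_mult_cnj[OF w] assms(3,4) by (auto simp: kernel_def)
  next
    case 2
    then have "1 - cnj \<eta> * z \<noteq> 0" "1 - cnj \<zeta> * z \<noteq> 0"
      using boundary_kernel_denom_neq_0 assms by auto
    then show ?thesis
      by (simp add: kernel_def assms(3,4) divide_simps) algebra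
  qed
qed

text \<open>The conjugate of the inner product with \<open>\<theta> h\<close> is a multiple of \<open>\<integral> z k h\<close>, and \<open>k h\<close> is in \<open>H\<^sup>2\<close> because
  \<open>k\<close> is bounded.\<close>

lemma boundary_kernel_scaled_model_space:
  assumes \<eta>: "norm \<eta> = 1"
  shows "(\<lambda>z. c * kernel \<theta> \<eta> z) \<in> model_space \<theta>"
proof -
  have H: "(\<lambda>z. c * kernel \<theta> \<eta> z) \<in> Hardy2"
    by (rule Hardy2_bounded_mult[of "\<lambda>_. c" _ "norm c", OF _ _ _ boundary_kernel_Hardy2(1)[OF \<eta>]])
       (auto simp: has_boundary_values_def)
  have "inner_circle (\<lambda>z. c * kernel \<theta> \<eta> z) (\<lambda>z. \<theta> z * h z) = 0" if h: "h \<in> Hardy2" for h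
  proof -
    obtain C where C: "\<And>z. norm z \<le> 1 \<Longrightarrow> norm (kernel \<theta> \<eta> z) \<le> C"
      using boundary_kernel_bounded[OF \<eta>] by blast
    have kh: "(\<lambda>z. kernel \<theta> \<eta> z * h z) \<in> Hardy2"
      by (rule Hardy2_bounded_mult[where C=C, OF boundary_kernel_has_boundary_values[OF \<eta>] _
            boundary_kernel_measurable[OF \<eta>] h]) (use C less_imp_le in blast)
    have "cnj (inner_circle (\<lambda>z. c * kernel \<theta> \<eta> z) (\<lambda>z. \<theta> z * h z))
        = (\<integral>z. cnj (c * kernel \<theta> \<eta> z * cnj (\<theta> z * h z)) \<partial>circle_measure)"
      unfolding inner_circle_def by (rule Bochner_Integration.integral_cnj[symmetric])
    also have "\<dots> = (\<integral>z. cnj c * \<theta> \<eta> * cnj \<eta> * (z ^ 1 * (kernel \<theta> \<eta> z * h z)) \<partial>circle_measure)"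
    proof (rule Bochner_Integration.integral_cong[OF refl])
      fix z assume "z \<in> space circle_measure"
      then have "norm z = 1" by (simp add: space_circle_measure)
      from cnj_boundary_kernel[OF \<eta> this]
      show "cnj (c * kernel \<theta> \<eta> z * cnj (\<theta> z * h z)) = cnj c * \<theta> \<eta> * cnj \<eta> * (z ^ 1 * (kernel \<theta> \<eta> z * h z))"
        by (simp add: mult_ac)
    qed
    also have "\<dots> = 0"
      using Hardy2_integral_power_eq_0[OF kh, of 1] by simp
    finally show ?thesis by simp
  qed
  then show ?thesis using H by (simp add: model_space_def)
qed

text \<open>The mean of the kernel over the circle is its value at \<open>0\<close>, which is not zero as
  \<open>\<bar>\<theta>(0)\<bar> < 1\<close>. Hence the kernel is not almost everywhere zero.\<close>

lemma norm_boundary_kernel_neq_0: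
  assumes \<eta>: "norm \<eta> = 1" and n: "0 < n"
  shows "norm_circle (kernel \<theta> \<eta>) \<noteq> 0"
proof
  let ?k = "kernel \<theta> \<eta>"
  assume "norm_circle ?k = 0"
  moreover have "inner_circle ?k ?k = of_real (\<integral>z. (norm (?k z))\<^sup>2 \<partial>circle_measure)"
    by (simp add: inner_circle_def flip: complex_norm_square of_real_power)
  ultimately have "(\<integral>z. (norm (?k z))\<^sup>2 \<partial>circle_measure) = 0"
    by (simp add: norm_circle_def)
  moreover have L2: "?k \<in> L2_circle" using boundary_kernel_Hardy2[OF \<eta>] by (simp add: Hardy2_iff)
  ultimately have "AE z in circle_measure. (norm (?k z))\<^sup>2 = 0"
    by (subst (asm) integral_nonneg_eq_0_iff_AE) (auto simp: L2_circle_def)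
  then have "(\<integral>z. ?k z * cnj z ^ 0 \<partial>circle_measure) = (\<integral>z. 0 \<partial>circle_measure)"
    using boundary_kernel_measurable[OF \<eta>] by (intro integral_cong_AE) auto
  moreover have "(\<integral>z. ?k z * cnj z ^ 0 \<partial>circle_measure) = ?k 0"
    using Fourier_coefficient_boundary_values[OF L2 boundary_kernel_has_boundary_values[OF \<eta>]
        boundary_kernel_Hardy2(2)[OF \<eta>], of 0] by simp
  ultimately have "cnj (\<theta> \<eta>) * \<theta> 0 = 1" by (simp add: kernel_def)
  then have "norm (\<theta> \<eta>) * norm (\<theta> 0) = 1" by (metis complex_mod_cnj norm_mult norm_one)
  moreover have "norm (\<theta> \<eta>) = 1" "norm (\<theta> 0) < 1"
    using finite_Blaschke_norm[OF \<theta>] \<eta> n by auto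
  ultimately show False by simp
qed

end

section \<open>Matrices with respect to modified Clark bases\<close>

lemma truncated_Toeplitz_inner:
  assumes "truncated_Toeplitz \<theta> A"
  obtains \<phi> where "\<phi> \<in> Linf_circle"
    "\<And>f g. f \<in> model_space \<theta> \<Longrightarrow> g \<in> model_space \<theta> \<Longrightarrow>
       inner_circle (A f) g = inner_circle (\<lambda>z. \<phi> z * f z) g"
proof -
  from assms obtain \<phi> where \<phi>: "\<phi> \<in> Linf_circle"
    and A: "\<And>f. f \<in> model_space \<theta> \<Longrightarrow> is_orthogonal_projection (model_space \<theta>) (\<lambda>z. \<phi> z * f z) (A f)"
    by (auto simp: truncated_Toeplitz_def)
  have L2: "f \<in> L2_circle" if "f \<in> model_space \<theta>" for f
    using that by (simp add: model_space_def Hardy2_def)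
  show thesis
  proof (rule that[OF \<phi>])
    fix f g assume fg: "f \<in> model_space \<theta>" "g \<in> model_space \<theta>"
    have "(\<lambda>z. \<phi> z * f z) \<in> L2_circle"
      using \<phi> L2_bounded_mult[OF _ _ L2[OF fg(1)]] by (auto simp: Linf_circle_def)
    then have "integrable circle_measure (\<lambda>z. \<phi> z * f z * cnj (g z))"
      by (rule L2_integrable_mult_cnj[OF _ L2[OF fg(2)]])
    moreover have "A f \<in> model_space \<theta>"
      "inner_circle (\<lambda>z. \<phi> z * f z - A f z) g = 0"
      using A[OF fg(1)] fg(2) by (auto simp: is_orthogonal_projection_def)
    moreover from this(1) have "integrable circle_measure (\<lambda>z. A f z * cnj (g z))"
      using L2_integrable_mult_cnj L2 fg(2) by blast
    ultimately show "inner_circle (A f) g = inner_circle (\<lambda>z. \<phi> z * f z) g"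
      by (simp add: inner_circle_def left_diff_distrib)
  qed
qed

text \<open>By partial fractions, an off-diagonal entry is a nonzero multiple of \<open>p i - p j\<close>, where \<open>p i\<close> is the
  integral of \<open>\<phi> g k\<^sub>i\<close> for \<open>g = cnj \<theta> (1 - cnj w \<theta>)\<close>. The phases and norms in the definition of the basis
  only contribute the nonzero factors \<open>\<kappa>\<close>. Consequently the zero pattern off the diagonal is an
  equivalence relation on the indices.\<close>

theorem Clark_matrix_off_diagonal_zeros:
  fixes v :: "'n::finite \<Rightarrow> complex \<Rightarrow> complex"
  assumes \<theta>: "finite_Blaschke n \<theta>" and n: "0 < n" and v: "modified_Clark_basis \<theta> v"
    and A: "truncated_Toeplitz \<theta> A"
  obtains p :: "'n \<Rightarrow> complex"
  where "\<And>i j. i \<noteq> j \<Longrightarrow> matrix_representation A v $ i $ j = 0 \<longleftrightarrow> p i = p j"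
proof -
  from v obtain t \<alpha> w \<eta> where t: "norm t < 1" and \<alpha>: "norm \<alpha> = 1"
    and w_def: "w = (\<alpha> + \<theta> t) / (1 + cnj (\<theta> t) * \<alpha>)"
    and bij: "bij_betw \<eta> UNIV {z \<in> cball 0 1. \<theta> z = w}"
    and v_def: "v = (\<lambda>i z. cis ((Arg2pi (cnj (\<eta> i)) + Arg2pi w) / 2) *
            (kernel \<theta> (\<eta> i) z / of_real (norm_circle (kernel \<theta> (\<eta> i)))))"
    unfolding modified_Clark_basis_def by blast
  have "norm (\<theta> t) < 1" using finite_Blaschke_norm(2)[OF \<theta>] t n by simp
  then have d: "1 + cnj (\<theta> t) * \<alpha> \<noteq> 0"
    using Blaschke_factor_denom_neq_0[of "\<theta> t" "- \<alpha>"] \<alpha> by simp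
  \<comment> \<open>numerator and denominator of \<open>w\<close> are conjugate up to the factor \<open>\<alpha>\<close>\<close>
  have "norm w = 1"
  proof -
    have "1 + cnj (\<theta> t) * \<alpha> = \<alpha> * cnj (\<alpha> + \<theta> t)"
      using unimodular_mult_cnj(1)[OF \<alpha>] by (simp add: distrib_left mult.commute)
    then have "norm (1 + cnj (\<theta> t) * \<alpha>) = norm (\<alpha> + \<theta> t)"
      using \<alpha> by (metis complex_mod_cnj mult_1 norm_mult)
    then show ?thesis using d unfolding w_def norm_divide by (metis divide_self norm_eq_zero)
  qed
  have \<theta>\<eta>: "\<theta> (\<eta> i) = w" and "norm (\<eta> i) \<le> 1" for i
    using bij by (auto simp: bij_betw_def)
  \<comment> \<open>in the open disc \<open>\<theta>\<close> is less than \<open>1\<close> in modulus, so it cannot take the value \<open>w\<close> there\<close>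
  then have \<eta>: "norm (\<eta> i) = 1" for i
    using finite_Blaschke_norm(2)[OF \<theta>, of "\<eta> i"] n \<open>norm w = 1\<close>
    by (metis less_irrefl order_le_less)
  have inj: "\<eta> i \<noteq> \<eta> j" if "i \<noteq> j" for i j
    using bij that by (auto simp: bij_betw_def inj_on_def)
  obtain \<phi> where \<phi>: "\<phi> \<in> Linf_circle" and inner_A:
    "\<And>f g. f \<in> model_space \<theta> \<Longrightarrow> g \<in> model_space \<theta> \<Longrightarrow>
       inner_circle (A f) g = inner_circle (\<lambda>z. \<phi> z * f z) g"
    using truncated_Toeplitz_inner[OF A] by blast
  define k where "k i = kernel \<theta> (\<eta> i)" for i
  define \<kappa> where "\<kappa> i = cis ((Arg2pi (cnj (\<eta> i)) + Arg2pi w) / 2) / of_real (norm_circle (k i))" for i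
  have \<kappa>0: "\<kappa> i \<noteq> 0" for i
    using norm_boundary_kernel_neq_0[OF \<theta> \<eta> n] by (simp add: \<kappa>_def k_def)
  have v_eq: "v i = (\<lambda>z. \<kappa> i * k i z)" for i
    by (simp add: v_def \<kappa>_def k_def)
  have v_model: "v i \<in> model_space \<theta>" for i
    unfolding v_eq k_def by (rule boundary_kernel_scaled_model_space[OF \<theta> \<eta>])
  define p where "p i = (\<integral>z. \<phi> z * (cnj (\<theta> z) * (1 - cnj w * \<theta> z) * k i z) \<partial>circle_measure)" for i
  have [measurable]: "\<phi> \<in> borel_measurable circle_measure"
    using \<phi> by (simp add: Linf_circle_def)
  have p_int: "integrable circle_measure (\<lambda>z. \<phi> z * (cnj (\<theta> z) * (1 - cnj w * \<theta> z) * k i z))" for i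
  proof -
    have "continuous_on (sphere 0 1) (\<lambda>z. cnj (\<theta> z) * (1 - cnj w * \<theta> z))"
      by (intro continuous_intros continuous_on_subset[OF finite_Blaschke_continuous[OF \<theta>]]) auto
    note m = measurable_circle_continuous_on[OF this]
    have "AE z in circle_measure. norm (cnj (\<theta> z) * (1 - cnj w * \<theta> z)) \<le> 2"
      using AE_circle_norm
    proof eventually_elim
      case (elim z)
      then have "norm (\<theta> z) = 1" using finite_Blaschke_norm(1)[OF \<theta>] by simp
      then show ?case
        using norm_triangle_ineq4[of 1 "cnj w * \<theta> z"] \<open>norm w = 1\<close> by (simp add: norm_mult)
    qed
    moreover have "k i \<in> L2_circle"
      using boundary_kernel_Hardy2(1)[OF \<theta> \<eta>] by (simp add: Hardy2_iff k_def)
    ultimately have "(\<lambda>z. cnj (\<theta> z) * (1 - cnj w * \<theta> z) * k i z) \<in> L2_circle"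
      using L2_bounded_mult[OF m] by blast
    then show ?thesis
      using \<phi> by (auto simp: Linf_circle_def intro!: L2_integrable L2_bounded_mult)
  qed
  have entry: "(cnj (\<eta> i) - cnj (\<eta> j)) * matrix_representation A v $ i $ j
      = \<kappa> j * cnj (\<kappa> i) * w * cnj (\<eta> i) * (p i - p j)" for i j
  proof -
    have "matrix_representation A v $ i $ j = (\<integral>z. \<phi> z * v j z * cnj (v i z) \<partial>circle_measure)"
      using inner_A[OF v_model v_model] by (simp add: matrix_representation_def inner_circle_def)
    then have "(cnj (\<eta> i) - cnj (\<eta> j)) * matrix_representation A v $ i $ j
        = (\<integral>z. (cnj (\<eta> i) - cnj (\<eta> j)) * (\<phi> z * v j z * cnj (v i z)) \<partial>circle_measure)"
      by simp
    also have "\<dots> = (\<integral>z. \<kappa> j * cnj (\<kappa> i) * w * cnj (\<eta> i) *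
         (\<phi> z * (cnj (\<theta> z) * (1 - cnj w * \<theta> z) * k i z) - \<phi> z * (cnj (\<theta> z) * (1 - cnj w * \<theta> z) * k j z)) \<partial>circle_measure)"
    proof (rule Bochner_Integration.integral_cong[OF refl])
      fix z assume "z \<in> space circle_measure"
      then have z: "norm z = 1" by (simp add: space_circle_measure)
      have \<theta>z: "\<theta> z * cnj (\<theta> z) = 1"
        using unimodular_mult_cnj(1) finite_Blaschke_norm(1)[OF \<theta>] z by simp
      have c: "cnj (k i z) = cnj (\<theta> z) * w * cnj (\<eta> i) * z * k i z"
        using cnj_boundary_kernel[OF \<theta> \<eta> z, of i] \<theta>z unfolding \<theta>\<eta> k_def[symmetric] by algebra
      have m: "(cnj (\<eta> i) - cnj (\<eta> j)) * z * (k i z * k j z) = (1 - cnj w * \<theta> z) * (k i z - k j z)"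
        using boundary_kernel_mult[OF \<theta> \<eta> \<eta> \<theta>\<eta> \<theta>\<eta>] by (simp add: k_def)
      have "(cnj (\<eta> i) - cnj (\<eta> j)) * (\<phi> z * v j z * cnj (v i z))
         = \<phi> z * \<kappa> j * cnj (\<kappa> i) * (cnj (\<theta> z) * w * cnj (\<eta> i)) * ((cnj (\<eta> i) - cnj (\<eta> j)) * z * (k i z * k j z))"
        by (simp add: v_eq c)
      also have "\<dots> = \<kappa> j * cnj (\<kappa> i) * w * cnj (\<eta> i) *
         (\<phi> z * (cnj (\<theta> z) * (1 - cnj w * \<theta> z) * k i z) - \<phi> z * (cnj (\<theta> z) * (1 - cnj w * \<theta> z) * k j z))"
        unfolding m by (simp add: algebra_simps)
      finally show "(cnj (\<eta> i) - cnj (\<eta> j)) * (\<phi> z * v j z * cnj (v i z)) = \<dots>" .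
    qed
    also have "\<dots> = \<kappa> j * cnj (\<kappa> i) * w * cnj (\<eta> i) * (p i - p j)"
      using p_int by (simp add: p_def)
    finally show ?thesis .
  qed
  show thesis
  proof
    fix i j :: 'n assume "i \<noteq> j"
    then have "cnj (\<eta> i) - cnj (\<eta> j) \<noteq> 0" using inj by simp
    moreover have "\<kappa> j * cnj (\<kappa> i) * w * cnj (\<eta> i) \<noteq> 0"
      using \<kappa>0 \<open>norm w = 1\<close> \<eta>[of i] by auto
    ultimately show "matrix_representation A v $ i $ j = 0 \<longleftrightarrow> p i = p j"
      using entry[of i j] by (metis mult_eq_0_iff right_minus_eq)
  qed
qed

section \<open>The model space of a power of \<open>z\<close>\<close>

lemma cnj_power_mult_power:
  assumes "norm z = 1" "k \<le> j"
  shows "z ^ j * cnj z ^ k = z ^ (j - k)"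
proof -
  have "z ^ j * cnj z ^ k = z ^ (j - k) * (z * cnj z) ^ k"
    using power_add[of z "j - k" k] assms(2) by (simp add: power_mult_distrib mult.assoc)
  then show ?thesis using unimodular_mult_cnj(1)[OF assms(1)] by simp
qed

lemma measurable_power_circle [measurable]: "(\<lambda>z. z ^ m) \<in> borel_measurable circle_measure"
  by measurable

lemma power_Hardy2: "(\<lambda>z. z ^ m) \<in> Hardy2"
  by (rule bounded_imp_Hardy2(1)[OF has_boundary_values_power norm_power_le_one]) auto

lemma power_L2: "(\<lambda>z. z ^ m) \<in> L2_circle"
  using power_Hardy2 by (simp add: Hardy2_def)

lemma inner_circle_power:
  "inner_circle (\<lambda>z. z ^ j) (\<lambda>z. z ^ k) = (if j = k then 1 else 0)"
proof -
  have *: "inner_circle (\<lambda>z. z ^ j) (\<lambda>z. z ^ k) = 0" if "k < j" for j k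
  proof -
    have "inner_circle (\<lambda>z. z ^ j) (\<lambda>z. z ^ k) = (\<integral>z. z ^ (j - k) * 1 \<partial>circle_measure)"
      unfolding inner_circle_def using that
      by (intro Bochner_Integration.integral_cong) (auto simp: space_circle_measure cnj_power_mult_power)
    then show ?thesis using Hardy2_integral_power_eq_0[OF Hardy2_one, of "j - k"] that by simp
  qed
  have sym: "inner_circle f g = cnj (inner_circle g f)" for f g
    unfolding inner_circle_def by (subst Bochner_Integration.integral_cnj[symmetric]) (simp add: mult.commute)
  have one: "inner_circle (\<lambda>z. z ^ j) (\<lambda>z. z ^ j) = 1" for j
  proof -
    have "inner_circle (\<lambda>z. z ^ j) (\<lambda>z. z ^ j) = (\<integral>z. 1 * cnj z ^ 0 \<partial>circle_measure)"
      unfolding inner_circle_def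
      by (intro Bochner_Integration.integral_cong) (auto simp: space_circle_measure cnj_power_mult_power)
    also have "\<dots> = (deriv ^^ 0) (\<lambda>_. 1) 0 / fact 0"
      by (rule Fourier_coefficient_boundary_values)
         (use Hardy2_one in \<open>auto simp: Hardy2_def has_boundary_values_def bounded_means_def\<close>)
    finally show ?thesis by simp
  qed
  consider "j < k" | "j = k" | "k < j" by linarith
  then show ?thesis
    by cases (use *[of j k] *[of k j] sym[of "\<lambda>z. z ^ j" "\<lambda>z. z ^ k"] one in auto)
qed

text \<open>Exponents are attached to the elements of a finite type, so that the coefficients form a vector on
  which matrices act. Below, \<open>e\<close> is a bijection onto \<open>{..<N}\<close>.\<close>

definition monomial_sum :: "('n::finite \<Rightarrow> nat) \<Rightarrow> complex^'n \<Rightarrow> complex \<Rightarrow> complex" where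
  "monomial_sum e y z = (\<Sum>i\<in>UNIV. y $ i * z ^ e i)"

lemma monomial_sum_L2: "monomial_sum e y \<in> L2_circle"
proof -
  have "continuous_on (sphere 0 1) (monomial_sum e y)"
    unfolding monomial_sum_def by (intro continuous_intros)
  moreover have "AE z in circle_measure. norm (monomial_sum e y z) \<le> (\<Sum>i\<in>UNIV. norm (y $ i))"
    using AE_circle_norm
    by eventually_elim (auto simp: monomial_sum_def norm_mult norm_power intro!: order_trans[OF norm_sum] sum_mono)
  ultimately show ?thesis
    using L2_bounded measurable_circle_continuous_on by blast
qed

lemma inner_circle_monomial_sum_right:
  assumes "f \<in> L2_circle"
  shows "inner_circle f (monomial_sum e y) = (\<Sum>i\<in>UNIV. inner_circle f (\<lambda>z. z ^ e i) * cnj (y $ i))"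
proof -
  have "inner_circle f (monomial_sum e y) = (\<integral>z. (\<Sum>i\<in>UNIV. f z * cnj (z ^ e i) * cnj (y $ i)) \<partial>circle_measure)"
    unfolding inner_circle_def monomial_sum_def by (simp add: sum_distrib_left mult_ac)
  also have "\<dots> = (\<Sum>i\<in>UNIV. \<integral>z. f z * cnj (z ^ e i) * cnj (y $ i) \<partial>circle_measure)"
    by (intro Bochner_Integration.integral_sum integrable_mult_left L2_integrable_mult_cnj assms power_L2)
  finally show ?thesis by (simp add: inner_circle_def)
qed

lemma inner_circle_monomial_sum_left:
  assumes "f \<in> L2_circle"
  shows "inner_circle (monomial_sum e y) f = (\<Sum>i\<in>UNIV. y $ i * inner_circle (\<lambda>z. z ^ e i) f)"
proof -
  have "inner_circle (monomial_sum e y) f = (\<integral>z. (\<Sum>i\<in>UNIV. y $ i * (z ^ e i * cnj (f z))) \<partial>circle_measure)"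
    unfolding inner_circle_def monomial_sum_def by (simp add: sum_distrib_right mult.assoc)
  also have "\<dots> = (\<Sum>i\<in>UNIV. \<integral>z. y $ i * (z ^ e i * cnj (f z)) \<partial>circle_measure)"
    by (intro Bochner_Integration.integral_sum integrable_mult_right L2_integrable_mult_cnj assms power_L2)
  finally show ?thesis by (simp add: inner_circle_def)
qed

lemma inner_circle_monomial_sum_power:
  assumes "inj e"
  shows "inner_circle (monomial_sum e y) (\<lambda>z. z ^ e i) = y $ i"
  using assms
  by (simp add: inner_circle_monomial_sum_left[OF power_L2] inner_circle_power inj_eq if_distrib cong: if_cong)

lemma inner_circle_monomial_sums:
  assumes "inj e"
  shows "inner_circle (monomial_sum e x) (monomial_sum e y) = (\<Sum>i\<in>UNIV. x $ i * cnj (y $ i))"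
  by (simp add: inner_circle_monomial_sum_right[OF monomial_sum_L2] inner_circle_monomial_sum_power[OF assms])

lemma eq_circle_inner:
  assumes "f =\<^sub>T f'" "g =\<^sub>T g'"
    and "f \<in> borel_measurable circle_measure" "f' \<in> borel_measurable circle_measure"
    and "g \<in> borel_measurable circle_measure" "g' \<in> borel_measurable circle_measure"
  shows "inner_circle f g = inner_circle f' g'"
proof -
  have [measurable]: "cnj \<in> borel_measurable borel"
    by (intro borel_measurable_continuous_onI continuous_intros)
  note assms(3-6)[measurable]
  have "AE z in circle_measure. f z * cnj (g z) = f' z * cnj (g' z)"
    using assms(1,2) unfolding eq_circle_def by eventually_elim simp
  then show ?thesis
    unfolding inner_circle_def by (intro integral_cong_AE) auto
qed

lemma finite_Blaschke_power: "finite_Blaschke N (\<lambda>z. z ^ N)"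
  unfolding finite_Blaschke_def by (rule exI[of _ 1], rule exI[of _ "\<lambda>_. 0"]) simp

context
  fixes e :: "'n::finite \<Rightarrow> nat" and N :: nat
  assumes e: "bij_betw e UNIV {..<N}"
begin

lemma inj_e: "inj e"
  using e by (simp add: bij_betw_def)

text \<open>On the circle, \<open>z\<^sup>N\<close> times the conjugate of a monomial of lower degree is a positive power of \<open>z\<close>.\<close>

lemma monomial_sum_model_space: "monomial_sum e y \<in> model_space (\<lambda>z. z ^ N)"
proof -
  have "has_boundary_values (monomial_sum e y) (monomial_sum e y)"
    unfolding monomial_sum_def
    by (intro has_boundary_values_continuous[of 1] continuous_intros holomorphic_intros) simp
  moreover have "norm (monomial_sum e y z) \<le> (\<Sum>i\<in>UNIV. norm (y $ i))" if "norm z < 1" for z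
    unfolding monomial_sum_def using norm_power_le_one[OF that]
    by (intro order_trans[OF norm_sum] sum_mono) (simp add: norm_mult mult_left_le)
  ultimately have H: "monomial_sum e y \<in> Hardy2"
    using bounded_imp_Hardy2(1)[of "monomial_sum e y" "monomial_sum e y" "\<Sum>i\<in>UNIV. norm (y $ i)"] monomial_sum_L2[of e y]
    by (auto simp: L2_circle_def)
  have "inner_circle (monomial_sum e y) (\<lambda>z. z ^ N * h z) = 0" if h: "h \<in> Hardy2" for h
  proof -
    have zh: "(\<lambda>z. z ^ N * h z) \<in> L2_circle"
      using Hardy2_bounded_mult[OF has_boundary_values_power norm_power_le_one _ h] by (auto simp: Hardy2_def)
    have "inner_circle (\<lambda>z. z ^ e i) (\<lambda>z. z ^ N * h z) = 0" for i
    proof -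
      have i: "e i < N" using e by (auto simp: bij_betw_def)
      have "cnj (inner_circle (\<lambda>z. z ^ e i) (\<lambda>z. z ^ N * h z))
          = (\<integral>z. cnj (z ^ e i * cnj (z ^ N * h z)) \<partial>circle_measure)"
        unfolding inner_circle_def by (rule Bochner_Integration.integral_cnj[symmetric])
      also have "\<dots> = (\<integral>z. z ^ (N - e i) * h z \<partial>circle_measure)"
      proof (rule Bochner_Integration.integral_cong[OF refl])
        fix z assume "z \<in> space circle_measure"
        then have "z ^ N * cnj z ^ e i = z ^ (N - e i)"
          using cnj_power_mult_power[of z "e i" N] i by (simp add: space_circle_measure)
        moreover have "cnj (z ^ e i * cnj (z ^ N * h z)) = z ^ N * cnj z ^ e i * h z"
          by simp
        ultimately show "cnj (z ^ e i * cnj (z ^ N * h z)) = z ^ (N - e i) * h z"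
          by simp
      qed
      also have "\<dots> = 0"
        using i by (intro Hardy2_integral_power_eq_0[OF h]) simp
      finally show ?thesis by simp
    qed
    then show ?thesis by (simp add: inner_circle_monomial_sum_left[OF zh])
  qed
  then show ?thesis using H by (simp add: model_space_def)
qed

text \<open>Orthogonality to \<open>z\<^sup>N z\<^sup>m\<close> kills all Taylor coefficients of the extension from index \<open>N\<close> on. So the
  extension is a polynomial, and its radial limits are its values.\<close>

lemma model_space_power_monomial_sum:
  assumes f: "f \<in> model_space (\<lambda>z. z ^ N)"
  obtains y where "monomial_sum e y =\<^sub>T f"
proof -
  from f obtain F where F: "has_boundary_values F f" "bounded_means F" and fL2: "f \<in> L2_circle"
    and orth: "\<And>h. h \<in> Hardy2 \<Longrightarrow> inner_circle f (\<lambda>z. z ^ N * h z) = 0"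
    by (auto simp: model_space_def Hardy2_iff)
  have hol: "F holomorphic_on ball 0 1" using F by (simp add: has_boundary_values_def)
  have zero: "(deriv ^^ k) F 0 / fact k = 0" if "N \<le> k" for k
    using orth[OF power_Hardy2[of "k - N"]] that
      Fourier_coefficient_boundary_values[OF fL2 F, of k]
    by (simp add: inner_circle_def flip: power_add)
  define y :: "complex^'n" where "y = (\<chi> i. (deriv ^^ e i) F 0 / fact (e i))"
  have F_eq: "F z = monomial_sum e y z" if "norm z < 1" for z
  proof -
    have "(\<lambda>k. (deriv ^^ k) F 0 / fact k * (z - 0) ^ k) sums F z"
      by (rule holomorphic_power_series[OF hol]) (use that in simp)
    moreover have "(\<lambda>k. (deriv ^^ k) F 0 / fact k * (z - 0) ^ k) sums
        (\<Sum>k<N. (deriv ^^ k) F 0 / fact k * (z - 0) ^ k)"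
      by (rule sums_finite) (use zero in \<open>auto simp: not_less\<close>)
    ultimately have "F z = (\<Sum>k<N. (deriv ^^ k) F 0 / fact k * (z - 0) ^ k)"
      by (rule sums_unique2)
    also have "\<dots> = monomial_sum e y z"
      unfolding monomial_sum_def y_def
      using sum.reindex_bij_betw[OF e, of "\<lambda>k. (deriv ^^ k) F 0 / fact k * z ^ k"] by simp
    finally show ?thesis .
  qed
  have "AE z in circle_measure. ((\<lambda>r::real. F (of_real r * z)) \<longlongrightarrow> f z) (at_left 1)"
    using F by (simp add: has_boundary_values_def)
  then have "AE z in circle_measure. monomial_sum e y z = f z"
    using AE_circle_norm
  proof eventually_elim
    case (elim z)
    have "eventually (\<lambda>r::real. r \<in> {0<..<1}) (at_left 1)"
      by (rule eventually_at_left_real) simp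
    then have "eventually (\<lambda>r::real. monomial_sum e y (of_real r * z) = F (of_real r * z)) (at_left 1)"
      by eventually_elim (use elim(2) in \<open>auto simp: norm_mult F_eq\<close>)
    then have "((\<lambda>r::real. monomial_sum e y (of_real r * z)) \<longlongrightarrow> f z) (at_left 1)"
      using elim(1) by (simp cong: tendsto_cong)
    moreover have "((\<lambda>r::real. monomial_sum e y (of_real r * z)) \<longlongrightarrow> monomial_sum e y (of_real 1 * z)) (at_left 1)"
      unfolding monomial_sum_def by (intro tendsto_intros)
    ultimately show ?case
      using tendsto_unique[of "at_left (1::real)"] by fastforce
  qed
  then show thesis using that by (simp add: eq_circle_def)
qed

text \<open>The truncated Toeplitz operator with symbol \<open>\<phi>\<close>: the orthogonal projection is written out in the
  orthonormal basis of monomials, which singles out one representative of each class of functions.\<close>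

definition compression :: "(complex \<Rightarrow> complex) \<Rightarrow> (complex \<Rightarrow> complex) \<Rightarrow> complex \<Rightarrow> complex" where
  "compression \<phi> f = monomial_sum e (\<chi> i. inner_circle (\<lambda>z. \<phi> z * f z) (\<lambda>z. z ^ e i))"

lemma truncated_Toeplitz_compression:
  assumes \<phi>: "\<phi> \<in> Linf_circle"
  shows "truncated_Toeplitz (\<lambda>z. z ^ N) (compression \<phi>)"
  unfolding truncated_Toeplitz_def
proof (intro bexI[OF _ \<phi>] ballI)
  fix f assume "f \<in> model_space (\<lambda>z. z ^ N)"
  then have "f \<in> L2_circle" by (simp add: model_space_def Hardy2_def)
  then have \<phi>f: "(\<lambda>z. \<phi> z * f z) \<in> L2_circle"
    using \<phi> by (auto simp: Linf_circle_def intro!: L2_bounded_mult)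
  define y :: "complex^'n" where "y = (\<chi> i. inner_circle (\<lambda>z. \<phi> z * f z) (\<lambda>z. z ^ e i))"
  have c: "compression \<phi> f = monomial_sum e y"
    by (simp add: compression_def y_def)
  have "(\<lambda>z. - 1 * monomial_sum e y z) \<in> L2_circle"
    by (rule L2_bounded_mult[OF _ _ monomial_sum_L2]) auto
  from L2_add[OF \<phi>f this] have d: "(\<lambda>z. \<phi> z * f z - monomial_sum e y z) \<in> L2_circle" by simp
  have "inner_circle (\<lambda>z. \<phi> z * f z - compression \<phi> f z) h = 0" if h: "h \<in> model_space (\<lambda>z. z ^ N)" for h
  proof -
    obtain x where x: "monomial_sum e x =\<^sub>T h"
      using model_space_power_monomial_sum[OF h] .
    have "inner_circle (\<lambda>z. \<phi> z * f z - monomial_sum e y z) h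
        = inner_circle (\<lambda>z. \<phi> z * f z - monomial_sum e y z) (monomial_sum e x)"
      using x h d monomial_sum_L2[of e x]
      by (intro eq_circle_inner) (auto simp: eq_circle_def L2_circle_def model_space_def Hardy2_def)
    also have "\<dots> = (\<Sum>i\<in>UNIV. inner_circle (\<lambda>z. \<phi> z * f z - monomial_sum e y z) (\<lambda>z. z ^ e i) * cnj (x $ i))"
      by (rule inner_circle_monomial_sum_right[OF d])
    also have "\<dots> = 0"
    proof (rule sum.neutral, rule ballI)
      fix i
      have "inner_circle (\<lambda>z. \<phi> z * f z - monomial_sum e y z) (\<lambda>z. z ^ e i)
         = inner_circle (\<lambda>z. \<phi> z * f z) (\<lambda>z. z ^ e i) - inner_circle (monomial_sum e y) (\<lambda>z. z ^ e i)"
        using L2_integrable_mult_cnj[OF \<phi>f power_L2] L2_integrable_mult_cnj[OF monomial_sum_L2[of e y] power_L2]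
        by (simp add: inner_circle_def left_diff_distrib)
      then show "inner_circle (\<lambda>z. \<phi> z * f z - monomial_sum e y z) (\<lambda>z. z ^ e i) * cnj (x $ i) = 0"
        by (simp add: inner_circle_monomial_sum_power[OF inj_e] y_def)
    qed
    finally show ?thesis by (simp add: c)
  qed
  then show "is_orthogonal_projection (model_space (\<lambda>z. z ^ N)) (\<lambda>z. \<phi> z * f z) (compression \<phi> f)"
    using monomial_sum_model_space by (simp add: is_orthogonal_projection_def c)
qed

lemma compression_monomial_sum:
  assumes \<phi>: "\<phi> \<in> Linf_circle"
    and T: "\<And>i j. T $ i $ j = inner_circle (\<lambda>z. \<phi> z * z ^ e j) (\<lambda>z. z ^ e i)"
  shows "compression \<phi> (monomial_sum e y) = monomial_sum e (T *v y)"
proof -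
  have int: "integrable circle_measure (\<lambda>z. \<phi> z * z ^ e j * cnj (z ^ e i))" for i j
  proof (rule L2_integrable_mult_cnj[OF _ power_L2])
    show "(\<lambda>z. \<phi> z * z ^ e j) \<in> L2_circle"
      using \<phi> power_L2[of "e j"] by (auto simp: Linf_circle_def intro!: L2_bounded_mult)
  qed
  have "inner_circle (\<lambda>z. \<phi> z * monomial_sum e y z) (\<lambda>z. z ^ e i) = (T *v y) $ i" for i
  proof -
    have "inner_circle (\<lambda>z. \<phi> z * monomial_sum e y z) (\<lambda>z. z ^ e i)
       = (\<integral>z. (\<Sum>j\<in>UNIV. \<phi> z * z ^ e j * cnj (z ^ e i) * y $ j) \<partial>circle_measure)"
      unfolding inner_circle_def monomial_sum_def
      by (simp add: sum_distrib_left sum_distrib_right mult_ac)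
    also have "\<dots> = (\<Sum>j\<in>UNIV. \<integral>z. \<phi> z * z ^ e j * cnj (z ^ e i) * y $ j \<partial>circle_measure)"
      by (intro Bochner_Integration.integral_sum integrable_mult_left int)
    also have "\<dots> = (\<Sum>j\<in>UNIV. T $ i $ j * y $ j)"
      by (simp add: T inner_circle_def)
    finally show ?thesis by (simp add: matrix_vector_mult_def)
  qed
  then show ?thesis by (simp add: compression_def vec_eq_iff)
qed

end

text \<open>The symbol is the trigonometric polynomial whose Fourier coefficients are read off from the first
  column (nonnegative frequencies) and the first row (nonpositive frequencies) of the matrix.\<close>

lemma Toeplitz_symbol_exists:
  fixes t :: "nat \<Rightarrow> nat \<Rightarrow> complex"
  assumes t: "\<And>i j m. t (i + m) (j + m) = t i j"
  obtains \<phi> where "\<phi> \<in> Linf_circle"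
    "\<And>i j. i < N \<Longrightarrow> j < N \<Longrightarrow> inner_circle (\<lambda>z. \<phi> z * z ^ j) (\<lambda>z. z ^ i) = t i j"
proof -
  define \<phi> where "\<phi> z = t 0 0 + (\<Sum>m\<in>{1..<N}. t m 0 * z ^ m + t 0 m * cnj z ^ m)" for z
  have cont: "continuous_on (sphere 0 1) \<phi>"
    unfolding \<phi>_def by (intro continuous_intros)
  then have "bounded (\<phi> ` sphere 0 1)"
    by (intro compact_imp_bounded compact_continuous_image) auto
  then obtain C where C: "\<And>z. norm z = 1 \<Longrightarrow> norm (\<phi> z) \<le> C"
    unfolding bounded_iff by (metis imageI mem_sphere_0)
  have "AE z in circle_measure. norm (\<phi> z) \<le> C"
    using AE_circle_norm by eventually_elim (rule C)
  then have "\<phi> \<in> Linf_circle"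
    using measurable_circle_continuous_on[OF cont] by (auto simp: Linf_circle_def)
  moreover have "inner_circle (\<lambda>z. \<phi> z * z ^ j) (\<lambda>z. z ^ i) = t i j" if ij: "i < N" "j < N" for i j
  proof -
    have int: "integrable circle_measure (\<lambda>z. z ^ p * cnj (z ^ q))" for p q
      by (rule L2_integrable_mult_cnj[OF power_L2 power_L2])
    have val: "(\<integral>z. z ^ p * cnj (z ^ q) \<partial>circle_measure) = (if p = q then 1 else 0)" for p q
      using inner_circle_power[of p q] by (simp add: inner_circle_def)
    have "inner_circle (\<lambda>z. \<phi> z * z ^ j) (\<lambda>z. z ^ i)
      = (\<integral>z. t 0 0 * (z ^ j * cnj (z ^ i)) +
          (\<Sum>m\<in>{1..<N}. t m 0 * (z ^ (m + j) * cnj (z ^ i)) + t 0 m * (z ^ j * cnj (z ^ (m + i)))) \<partial>circle_measure)"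
      unfolding inner_circle_def \<phi>_def
      by (simp add: distrib_right distrib_left sum_distrib_right sum_distrib_left power_add mult_ac)
    also have "\<dots> = t 0 0 * (\<integral>z. z ^ j * cnj (z ^ i) \<partial>circle_measure) +
          (\<Sum>m\<in>{1..<N}. t m 0 * (\<integral>z. z ^ (m + j) * cnj (z ^ i) \<partial>circle_measure)
             + t 0 m * (\<integral>z. z ^ j * cnj (z ^ (m + i)) \<partial>circle_measure))"
      using int by (simp add: Bochner_Integration.integral_add Bochner_Integration.integral_sum del: complex_cnj_power)
    also have "\<dots> = t 0 0 * (if j = i then 1 else 0) +
          (\<Sum>m\<in>{1..<N}. t m 0 * (if m + j = i then 1 else 0) + t 0 m * (if j = m + i then 1 else 0))"
      by (simp only: val)
    also have "\<dots> = t i j"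
    proof -
      consider "i = j" | "i < j" | "j < i" by linarith
      then show ?thesis
      proof cases
        case 1
        then show ?thesis using t[of 0 i 0] by simp
      next
        case 2
        have "(\<Sum>m\<in>{1..<N}. t m 0 * (if m + j = i then 1 else 0) + t 0 m * (if j = m + i then 1 else 0))
           = (\<Sum>m\<in>{1..<N}. if m = j - i then t 0 (j - i) else 0)"
          using 2 by (intro sum.cong) auto
        also have "\<dots> = t 0 (j - i)" using 2 ij by (subst sum.delta) auto
        finally show ?thesis using 2 t[of 0 i "j - i"] by simp
      next
        case 3
        have "(\<Sum>m\<in>{1..<N}. t m 0 * (if m + j = i then 1 else 0) + t 0 m * (if j = m + i then 1 else 0))
           = (\<Sum>m\<in>{1..<N}. if m = i - j then t (i - j) 0 else 0)"
          using 3 by (intro sum.cong) auto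
        also have "\<dots> = t (i - j) 0" using 3 ij by (subst sum.delta) auto
        finally show ?thesis using 3 t[of "i - j" j 0] by simp
      qed
    qed
    finally show ?thesis .
  qed
  ultimately show thesis using that by blast
qed

section \<open>Circulant matrices\<close>

definition adj :: "complex^'n^'m \<Rightarrow> complex^'m^'n" where
  "adj U = (\<chi> i j. cnj (U $ j $ i))"

definition diag :: "('n \<Rightarrow> complex) \<Rightarrow> complex^'n^'n" where
  "diag d = (\<chi> i j. if i = j then d i else 0)"

lemma adj_mult: "adj (A ** B) = adj B ** adj A"
  by (simp add: adj_def matrix_matrix_mult_def vec_eq_iff mult.commute)

lemma adj_adj: "adj (adj A) = A"
  by (simp add: adj_def vec_eq_iff)

lemma sum_cnj_adj:
  "(\<Sum>i\<in>UNIV. (V *v x) $ i * cnj (y $ i)) = (\<Sum>j\<in>UNIV. x $ j * cnj ((adj V *v y) $ j))"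
proof -
  have "(\<Sum>i\<in>UNIV. (V *v x) $ i * cnj (y $ i)) = (\<Sum>i\<in>UNIV. \<Sum>j\<in>UNIV. V $ i $ j * x $ j * cnj (y $ i))"
    by (simp add: matrix_vector_mult_def sum_distrib_right)
  also have "\<dots> = (\<Sum>j\<in>UNIV. \<Sum>i\<in>UNIV. V $ i $ j * x $ j * cnj (y $ i))"
    by (rule sum.swap)
  also have "\<dots> = (\<Sum>j\<in>UNIV. x $ j * cnj ((adj V *v y) $ j))"
    by (simp add: adj_def matrix_vector_mult_def sum_distrib_left mult_ac)
  finally show ?thesis .
qed

text \<open>An entry of \<open>adj F ** F\<close> is a geometric sum over the powers of \<open>cnj (\<omega> k) * \<omega> l\<close>, an \<open>N\<close>-th root of
  unity that is \<open>1\<close> only for \<open>k = l\<close>.\<close>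

lemma Fourier_matrix_unitary:
  fixes e :: "'n::finite \<Rightarrow> nat"
  assumes e: "bij_betw e UNIV {..<CARD('n)}"
    and \<omega>: "\<And>k. \<omega> k = cis (2 * pi * real (e k) / CARD('n))"
    and F: "F = (\<chi> i k. \<omega> k ^ e i / of_real (sqrt CARD('n)))"
  shows "adj F ** F = mat 1"
proof -
  let ?N = "CARD('n)"
  have N: "0 < ?N" by simp
  have u: "cnj (\<omega> k) * \<omega> k = 1" for k
    unfolding \<omega> by (simp add: cis_cnj cis_mult)
  have lt: "e k < ?N" for k
    using bij_betwE[OF e] by simp
  note bij = Complex.bij_betw_roots_unity[OF N]
  have root: "\<omega> k ^ ?N = 1" for k
    using bij_betwE[OF bij] lt[of k] unfolding \<omega> by simp
  have inj: "\<omega> k \<noteq> \<omega> l" if "k \<noteq> l" for k l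
  proof
    assume "\<omega> k = \<omega> l"
    then have "e k = e l"
      unfolding \<omega> using bij_betw_imp_inj_on[OF bij] lt by (auto dest: inj_onD)
    then show False
      using that e by (auto simp: bij_betw_def dest: injD)
  qed
  have ent: "(adj F ** F) $ k $ l = (\<Sum>i<?N. (cnj (\<omega> k) * \<omega> l) ^ i) / of_nat ?N" for k l
  proof -
    have "of_real (sqrt ?N) * of_real (sqrt ?N) = (of_nat ?N :: complex)"
      by (simp flip: of_real_mult)
    then have "(adj F ** F) $ k $ l = (\<Sum>i\<in>UNIV. (cnj (\<omega> k) * \<omega> l) ^ e i / of_nat ?N)"
      by (simp add: adj_def F matrix_matrix_mult_def power_mult_distrib)
    also have "\<dots> = (\<Sum>i<?N. (cnj (\<omega> k) * \<omega> l) ^ i / of_nat ?N)"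
      by (rule sum.reindex_bij_betw[OF e])
    finally show ?thesis by (simp add: sum_divide_distrib)
  qed
  have "(\<Sum>i<?N. (cnj (\<omega> k) * \<omega> l) ^ i) = (if k = l then of_nat ?N else 0)" for k l
  proof (cases "k = l")
    case False
    define x where "x = cnj (\<omega> k) * \<omega> l"
    have "x \<noteq> 1"
    proof
      assume "x = 1"
      then have "\<omega> k = \<omega> k * cnj (\<omega> k) * \<omega> l" by (simp add: x_def mult.assoc)
      also have "\<dots> = \<omega> l" using u[of k] by (simp add: mult.commute)
      finally show False using inj[OF False] by blast
    qed
    moreover have "x ^ ?N = 1"
      using root by (simp add: x_def power_mult_distrib flip: complex_cnj_power)
    ultimately show ?thesis using False by (simp add: x_def geometric_sum)
  qed (simp add: u)
  then show ?thesis
    by (simp add: vec_eq_iff ent mat_def)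
qed

text \<open>With \<open>F\<close> the discrete Fourier matrix, \<open>T = F ** diag d ** adj F\<close> is Toeplitz, since shifting both
  indices of an entry multiplies each summand by \<open>\<omega> k * cnj (\<omega> k) = 1\<close>. It has the same eigenvalues as \<open>S\<close>, and
  \<open>V = F ** adj U\<close> intertwines \<open>S\<close> and \<open>T\<close>.\<close>

theorem unitarily_diagonalizable_imp_TTO:
  fixes S U :: "complex^'n^'n::finite"
  assumes U: "adj U ** U = mat 1" and SU: "S ** U = U ** diag d"
  shows "\<exists>n \<theta> A. finite_Blaschke n \<theta> \<and> truncated_Toeplitz \<theta> A \<and>
            unitarily_equivalent S (model_space \<theta>) A"
proof -
  let ?N = "CARD('n)"
  obtain e :: "'n \<Rightarrow> nat" where e: "bij_betw e UNIV {..<?N}"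
    using ex_bij_betw_finite_nat[of "UNIV :: 'n set"] by (auto simp: atLeast0LessThan)
  define \<omega> where "\<omega> k = cis (2 * pi * real (e k) / ?N)" for k
  define F :: "complex^'n^'n" where "F = (\<chi> i k. \<omega> k ^ e i / of_real (sqrt ?N))"
  have F: "adj F ** F = mat 1" by (rule Fourier_matrix_unitary[OF e \<omega>_def F_def])
  define T where "T = F ** diag d ** adj F"
  define t where "t i j = (\<Sum>k\<in>UNIV. \<omega> k ^ i * d k * cnj (\<omega> k) ^ j) / of_nat ?N" for i j
  have "t (i + m) (j + m) = t i j" for i j m
  proof -
    have "\<omega> k ^ (i + m) * d k * cnj (\<omega> k) ^ (j + m) = \<omega> k ^ i * d k * cnj (\<omega> k) ^ j" for k
    proof -
      have "\<omega> k ^ (i + m) * d k * cnj (\<omega> k) ^ (j + m)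
          = (\<omega> k * cnj (\<omega> k)) ^ m * (\<omega> k ^ i * d k * cnj (\<omega> k) ^ j)"
        by (simp add: power_add power_mult_distrib mult_ac)
      also have "\<omega> k * cnj (\<omega> k) = 1"
        by (rule unimodular_mult_cnj) (simp add: \<omega>_def)
      finally show ?thesis by simp
    qed
    then show ?thesis by (simp only: t_def)
  qed
  then obtain \<phi> where \<phi>: "\<phi> \<in> Linf_circle"
    and t: "\<And>i j. i < ?N \<Longrightarrow> j < ?N \<Longrightarrow> inner_circle (\<lambda>z. \<phi> z * z ^ j) (\<lambda>z. z ^ i) = t i j"
    using Toeplitz_symbol_exists[of t ?N] by blast
  have "T $ i $ j = t (e i) (e j)" for i j
  proof -
    have N: "of_real (sqrt ?N) * of_real (sqrt ?N) = (of_nat ?N :: complex)"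
      by (simp flip: of_real_mult)
    have "(F ** diag d) $ i $ k = F $ i $ k * d k" for i k
      by (simp add: matrix_matrix_mult_def diag_def if_distrib cong: if_cong)
    then have "T $ i $ j = (\<Sum>k\<in>UNIV. F $ i $ k * d k * cnj (F $ j $ k))"
      by (simp add: T_def matrix_matrix_mult_def[of "F ** diag d"] adj_def)
    also have "\<dots> = t (e i) (e j)"
      by (simp add: F_def t_def sum_divide_distrib flip: N)
    finally show ?thesis .
  qed
  then have T: "T $ i $ j = inner_circle (\<lambda>z. \<phi> z * z ^ e j) (\<lambda>z. z ^ e i)" for i j
    using t[of "e i" "e j"] bij_betwE[OF e] by simp
  define V where "V = F ** adj U"
  have FF: "F ** adj F = mat 1" and UU: "U ** adj U = mat 1"
    using F U matrix_left_right_inverse by blast+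
  have VV: "adj V ** V = mat 1" "V ** adj V = mat 1"
    unfolding V_def adj_mult adj_adj by (metis F FF U UU matrix_mul_assoc matrix_mul_rid)+
  have TV: "T ** V = V ** S"
  proof -
    have "adj U ** S = adj U ** (S ** U) ** adj U"
      by (metis UU matrix_mul_assoc matrix_mul_rid)
    also have "\<dots> = diag d ** adj U"
      unfolding SU by (metis U matrix_mul_assoc matrix_mul_lid)
    finally show ?thesis
      unfolding T_def V_def by (metis F matrix_mul_assoc matrix_mul_lid)
  qed
  define W where "W x = monomial_sum e (V *v x)" for x
  have inj: "inj e" using e by (simp add: bij_betw_def)
  have "unitary_onto (model_space (\<lambda>z. z ^ ?N)) W"
    unfolding unitary_onto_def
  proof (intro conjI allI ballI)
    show "W x \<in> model_space (\<lambda>z. z ^ ?N)" for x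
      unfolding W_def by (rule monomial_sum_model_space[OF e])
    show "W (x + y) =\<^sub>T (\<lambda>z. W x z + W y z)" for x y
      by (simp add: eq_circle_def W_def monomial_sum_def matrix_vector_right_distrib distrib_right sum.distrib)
    show "W (c *s x) =\<^sub>T (\<lambda>z. c * W x z)" for c x
      by (simp add: eq_circle_def W_def monomial_sum_def vector_scalar_commute sum_distrib_left mult.assoc)
    show "inner_circle (W x) (W y) = (\<Sum>i\<in>UNIV. x $ i * cnj (y $ i))" for x y
      by (simp add: W_def inner_circle_monomial_sums[OF inj] sum_cnj_adj matrix_vector_mul_assoc VV)
    show "\<exists>x. W x =\<^sub>T f" if f: "f \<in> model_space (\<lambda>z. z ^ ?N)" for f
    proof -
      obtain y where y: "monomial_sum e y =\<^sub>T f"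
        using model_space_power_monomial_sum[OF e f] .
      then have "W (adj V *v y) =\<^sub>T f"
        by (simp add: W_def matrix_vector_mul_assoc VV)
      then show ?thesis ..
    qed
  qed
  moreover have "W (S *v x) =\<^sub>T compression e \<phi> (W x)" for x
    by (simp add: eq_circle_def W_def compression_monomial_sum[OF e \<phi> T] matrix_vector_mul_assoc TV)
  ultimately have "unitarily_equivalent S (model_space (\<lambda>z. z ^ ?N)) (compression e \<phi>)"
    unfolding unitarily_equivalent_def by blast
  then show ?thesis
    using finite_Blaschke_power truncated_Toeplitz_compression[OF e \<phi>] by blast
qed

section \<open>Symmetric matrices with a single off-diagonal pair\<close>

text \<open>The vectors \<open>(c, s)\<close> and \<open>(-s, c)\<close> are eigenvectors of the matrix with rows \<open>(p, 1)\<close> and \<open>(1, q)\<close>, for the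
  eigenvalues \<open>l\<close> and \<open>m\<close>. In the proof, \<open>r\<close> is the slope of the first one.\<close>

lemma real_symmetric_2x2_rotation:
  fixes p q :: real
  obtains c s l m where "c\<^sup>2 + s\<^sup>2 = 1" "p * c + s = l * c" "c + q * s = l * s"
    "c - p * s = - (m * s)" "q * c - s = m * c"
proof -
  define r where "r = ((q - p) + sqrt ((p - q)\<^sup>2 + 4)) / 2"
  have "(sqrt ((p - q)\<^sup>2 + 4))\<^sup>2 = (p - q)\<^sup>2 + 4"
    by simp
  then have r: "r\<^sup>2 = 1 + (q - p) * r"
    by (simp add: r_def power2_eq_square field_simps)
  define c where "c = 1 / sqrt (1 + r\<^sup>2)"
  have "0 < 1 + r\<^sup>2" by (simp add: add_pos_nonneg)
  then have "c\<^sup>2 * (1 + r\<^sup>2) = 1"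
    by (simp add: c_def power_divide)
  then have "c\<^sup>2 + (r * c)\<^sup>2 = 1"
    by (simp add: power_mult_distrib algebra_simps)
  moreover have "c + q * (r * c) = (p + r) * (r * c)" "c - p * (r * c) = - ((q - r) * (r * c))"
    using r by algebra+
  ultimately show thesis
    by (intro that[of c "r * c" "p + r" "q - r"]) (auto simp: algebra_simps)
qed

lemma unitarily_diagonalizable_block:
  fixes a b c :: real and S :: "complex^3^3"
  assumes "S = vector [vector [of_real a, 0, 1], vector [0, of_real b, 0], vector [1, 0, of_real c]] \<or>
           S = vector [vector [of_real a, 1, 0], vector [1, of_real b, 0], vector [0, 0, of_real c]] \<or>
           S = vector [vector [of_real a, 0, 0], vector [0, of_real b, 1], vector [0, 1, of_real c]]"
  obtains U :: "complex^3^3" and d where "adj U ** U = mat 1" "S ** U = U ** diag d"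
proof -
  note mat_simps = adj_def diag_def matrix_matrix_mult_def vec_eq_iff forall_3 sum_3 mat_def
  have real_eqs: "(of_real x :: complex) = of_real y" if "x = y" for x y
    using that by simp
  from assms show thesis
  proof (elim disjE)
    assume S: "S = vector [vector [of_real a, 0, 1], vector [0, of_real b, 0], vector [1, 0, of_real c]]"
    obtain x y l m where e: "x\<^sup>2 + y\<^sup>2 = 1" "a * x + y = l * x" "x + c * y = l * y"
      "x - a * y = - (m * y)" "c * x - y = m * x"
      using real_symmetric_2x2_rotation .
    note E = e[THEN real_eqs, simplified of_real_add of_real_mult of_real_diff of_real_minus of_real_1 of_real_power]
    let ?U = "vector [vector [of_real x, 0, - of_real y], vector [0, 1, 0], vector [of_real y, 0, of_real x]] :: complex^3^3"
    have "adj ?U ** ?U = mat 1"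
      using E(1) by (simp add: mat_simps power2_eq_square algebra_simps)
    moreover have "S ** ?U = ?U ** diag (\<lambda>i. (vector [of_real l, of_real b, of_real m] :: complex^3) $ i)"
      using E(2-) by (simp add: mat_simps S algebra_simps)
    ultimately show thesis by (rule that)
  next
    assume S: "S = vector [vector [of_real a, 1, 0], vector [1, of_real b, 0], vector [0, 0, of_real c]]"
    obtain x y l m where e: "x\<^sup>2 + y\<^sup>2 = 1" "a * x + y = l * x" "x + b * y = l * y"
      "x - a * y = - (m * y)" "b * x - y = m * x"
      using real_symmetric_2x2_rotation .
    note E = e[THEN real_eqs, simplified of_real_add of_real_mult of_real_diff of_real_minus of_real_1 of_real_power]
    let ?U = "vector [vector [of_real x, - of_real y, 0], vector [of_real y, of_real x, 0], vector [0, 0, 1]] :: complex^3^3"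
    have "adj ?U ** ?U = mat 1"
      using E(1) by (simp add: mat_simps power2_eq_square algebra_simps)
    moreover have "S ** ?U = ?U ** diag (\<lambda>i. (vector [of_real l, of_real m, of_real c] :: complex^3) $ i)"
      using E(2-) by (simp add: mat_simps S algebra_simps)
    ultimately show thesis by (rule that)
  next
    assume S: "S = vector [vector [of_real a, 0, 0], vector [0, of_real b, 1], vector [0, 1, of_real c]]"
    obtain x y l m where e: "x\<^sup>2 + y\<^sup>2 = 1" "b * x + y = l * x" "x + c * y = l * y"
      "x - b * y = - (m * y)" "c * x - y = m * x"
      using real_symmetric_2x2_rotation .
    note E = e[THEN real_eqs, simplified of_real_add of_real_mult of_real_diff of_real_minus of_real_1 of_real_power]
    let ?U = "vector [vector [1, 0, 0], vector [0, of_real x, - of_real y], vector [0, of_real y, of_real x]] :: complex^3^3"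
    have "adj ?U ** ?U = mat 1"
      using E(1) by (simp add: mat_simps power2_eq_square algebra_simps)
    moreover have "S ** ?U = ?U ** diag (\<lambda>i. (vector [of_real a, of_real l, of_real m] :: complex^3) $ i)"
      using E(2-) by (simp add: mat_simps S algebra_simps)
    ultimately show thesis by (rule that)
  qed
qed

theorem corollary3p6:
  fixes a b c :: real and S :: "complex^3^3"
  assumes "S = vector [vector [of_real a, 0, 1], vector [0, of_real b, 0], vector [1, 0, of_real c]] \<or>
           S = vector [vector [of_real a, 1, 0], vector [1, of_real b, 0], vector [0, 0, of_real c]] \<or>
           S = vector [vector [of_real a, 0, 0], vector [0, of_real b, 1], vector [0, 1, of_real c]]"
  shows "(\<exists>n \<theta> A. finite_Blaschke n \<theta> \<and> truncated_Toeplitz \<theta> A \<and>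
            unitarily_equivalent S (model_space \<theta>) A) \<and>
         \<not> (\<exists>\<theta> (v :: 3 \<Rightarrow> complex \<Rightarrow> complex) A. finite_Blaschke 3 \<theta> \<and> modified_Clark_basis \<theta> v \<and>
              truncated_Toeplitz \<theta> A \<and> matrix_representation A v = S)"
proof
  obtain U :: "complex^3^3" and d where "adj U ** U = mat 1" "S ** U = U ** diag d"
    using unitarily_diagonalizable_block[OF assms] .
  then show "\<exists>n \<theta> A. finite_Blaschke n \<theta> \<and> truncated_Toeplitz \<theta> A \<and>
      unitarily_equivalent S (model_space \<theta>) A"
    by (rule unitarily_diagonalizable_imp_TTO)
  show "\<not> (\<exists>\<theta> (v :: 3 \<Rightarrow> complex \<Rightarrow> complex) A. finite_Blaschke 3 \<theta> \<and> modified_Clark_basis \<theta> v \<and>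
      truncated_Toeplitz \<theta> A \<and> matrix_representation A v = S)"
  proof
    assume "\<exists>\<theta> (v :: 3 \<Rightarrow> complex \<Rightarrow> complex) A. finite_Blaschke 3 \<theta> \<and> modified_Clark_basis \<theta> v \<and>
      truncated_Toeplitz \<theta> A \<and> matrix_representation A v = S"
    then obtain p :: "3 \<Rightarrow> complex" where p: "\<And>i j. i \<noteq> j \<Longrightarrow> S $ i $ j = 0 \<longleftrightarrow> p i = p j"
      using Clark_matrix_off_diagonal_zeros by (metis zero_less_numeral)
    \<comment> \<open>two of the three off-diagonal pairs vanish, so all \<open>p i\<close> agree and the third pair vanishes as well\<close>
    show False
      using assms p[of 1 2] p[of 2 3] p[of 1 3] by auto
  qed
qed

end
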